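(* Let $N\ge D_1\ge3$ with $\log N\ge(\log D_1)^2$, and let $r\ge1$. Let $W\subseteq S_r(N)$ be a set of elements that are comfortably spaced above $D_1$ such that $\big||W|-\Phi_r(N)\big|<\epsilon\Phi_r(N)$ for some constant $\epsilon>0$. Let $V\subseteq S_r(N)$ and suppose there is a constant $\delta>0$ such that $\big||V\cap X|-\delta|X|\big|<\epsilon|X|$ for every box $X\subseteq S_r(N)$ with $X\cap W\neq\varnothing$. Then \[ |V|-\delta\Phi_r(N)\ll\left(\epsilon+\frac{1}{\log D_1}\right)\Phi_r(N). \]
   Context: $S_r(N)$ is the set of squarefree $n<N$ with exactly $r$ distinct prime factors, none congruent to $3\bmod4$; $\Phi_r(N)=\#S_r(N)$. An element $n$ with prime factors $p_1<\dots<p_r$ is comfortably spaced above $D_1$ if $2D_1<p_i<p_{i+1}/2$ for every $p_i>D_1$. A box (relative to $D_1$): for $0\le k\le r$, primes $p_1<\dots<p_k<D_1$ not congruent to $3\bmod4$ and reals $D_1<s_{k+1}<t_{k+1}<\dots<s_r<t_r$ with $t_i=\left(1+\frac{1}{e^{i-k}\log D_1}\right)s_i$, the box is $X=X_1\times\dots\times X_r$ with $X_i=\{p_i\}$ for $i\le k$ and $X_i=\{p\in(s_i,t_i)\text{ prime}:p\equiv1\bmod4\}$ for $i>k$; it is identified with the set of products $x_1\cdots x_r$, and $X\subseteq S_r(N)$ means all these products lie in $S_r(N)$.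
   Formalization: The bound is proved for the absolute value, with an absolute constant times max(1, δ); if the prime D_1 divides some element of W (such elements lie in no box), the constant may also depend on r. With a fully absolute constant the claim is false. *)

theory Defs
  imports Complex_Main "HOL-Library.FuncSet" "HOL-Computational_Algebra.Computational_Algebra"
begin

definition S :: "nat \<Rightarrow> real \<Rightarrow> nat set" where
  "S r N = {n. squarefree n \<and> real n < N \<and> card (prime_factors n) = r \<and>
               (\<forall>p\<in>prime_factors n. p mod 4 \<noteq> 3)}"

definition Phi :: "nat \<Rightarrow> real \<Rightarrow> nat" where
  "Phi r N = card (S r N)"

text \<open>The list \<open>ps\<close> is 0-based, so \<open>ps ! i\<close> is the paper's $p_{i+1}$. For the largest
  prime factor only the lower bound is required.\<close>

definition comfortably_spaced :: "real \<Rightarrow> nat \<Rightarrow> bool" where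
  "comfortably_spaced D1 n \<longleftrightarrow>
     (let ps = sorted_list_of_set (prime_factors n) in
      \<forall>i<length ps. D1 < real (ps ! i) \<longrightarrow>
        2 * D1 < real (ps ! i) \<and>
        (i + 1 < length ps \<longrightarrow> real (ps ! i) < real (ps ! (i + 1)) / 2))"

definition box_component ::
    "nat \<Rightarrow> (nat \<Rightarrow> nat) \<Rightarrow> (nat \<Rightarrow> real) \<Rightarrow> (nat \<Rightarrow> real) \<Rightarrow> nat \<Rightarrow> nat set" where
  "box_component k p s t i =
     (if i \<le> k then {p i}
      else {q. prime q \<and> q mod 4 = 1 \<and> s i < real q \<and> real q < t i})"

text \<open>Indices run from 1 to \<open>r\<close>, and a box is directly the set of products $x_1 \cdots x_r$. This
  loses no information and preserves cardinality: the components are pairwise disjoint sets of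
  primes, increasing in the index, so by unique factorisation the product map is injective on
  $X_1 \times \dots \times X_r$.\<close>

definition is_box :: "real \<Rightarrow> nat \<Rightarrow> nat set \<Rightarrow> bool" where
  "is_box D1 r X \<longleftrightarrow>
     (\<exists>k p s t. k \<le> r \<and>
        (\<forall>i\<in>{1..k}. prime (p i) \<and> p i mod 4 \<noteq> 3 \<and> real (p i) < D1) \<and>
        strict_mono_on {1..k} p \<and>
        (k < r \<longrightarrow> D1 < s (k + 1)) \<and>
        (\<forall>i\<in>{k+1..r}. s i < t i \<and>
           t i = (1 + 1 / (exp (real i - real k) * ln D1)) * s i) \<and>
        (\<forall>i\<in>{k+1..<r}. t i < s (i + 1)) \<and>
        X = (\<lambda>x. \<Prod>i\<in>{1..r}. x i) ` (\<Pi>\<^sub>E i\<in>{1..r}. box_component k p s t i))"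

end

theory Submission
  imports Defs "HOL-Analysis.Harmonic_Numbers" "HOL-Analysis.Continuum_Not_Denumerable"
    "HOL-Real_Asymp.Real_Asymp" "HOL-Number_Theory.Prime_Powers"
begin

text \<open>
  Fix a geometric grid for the primes above $D_1$ whose base point avoids all primes. An element of
  $W$ without prime factor $D_1$ then lies in exactly one grid box, the factor-$2$ spacing makes
  this a legitimate box, and distinct grid boxes are disjoint. Summing the hypothesis over the grid
  boxes inside $S_r(N)$ leaves an error of at most $\max(1,\delta)$ per uncovered element. Uncovered
  elements of $W$ satisfy $n \ge N(1 - 1/\log D_1)$ (a box varies only by a factor
  $e^{1/\log D_1}$), apart from those divisible by $D_1$. Write such an $n$ as $mq$ with $q > D_1$ the
  largest prime factor and put $x = N/m$. For given $m$, Brun--Titchmarsh bounds the number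
  of such $q$ by $O(x / (\log D_1 \log x))$, whereas $\gg x / \log x$ primes
  $q' \equiv 1 \bmod 4$ in $(x/2, x)$ give elements $mq'$ of $S_r(N)$; these exceed
  all primes of $m$ by the spacing, so $(m, q') \mapsto mq'$ is injective.
  If $D_1$ is a prime dividing $n$, replacing it by a smaller prime shows that
  such $n$ are rare, with a constant depending on $r$.
\<close>

section \<open>Selberg's upper bound sieve\<close>

text \<open>The boundary layer just below \<open>N\<close> must be small relative to
  \<open>Phi r N\<close>, uniformly in \<open>r\<close> and \<open>N\<close>. Its size is therefore
  never computed from an asymptotic formula for \<open>Phi r N\<close>: layer and main set are
  compared separately for each cofactor \<open>m\<close>, with only the largest prime moving. There
  an upper and a lower bound for primes that are correct up to constants suffice. The upper bound
  has to hold for an interval of length \<open>x / ln D1\<close> at a prescribed position; since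
  \<open>x > D1\<close>, this length is at least \<open>x / ln x\<close>, so its logarithm is
  comparable with \<open>ln x\<close> and only a constant is lost.

  The variation inside a box is independent of \<open>r\<close> because the relative widths decay
  like \<open>exp (-(i - k))\<close>. Boxes are attached to elements of \<open>W\<close>, as the
  hypothesis speaks only of boxes that meet \<open>W\<close>. A prime equal to \<open>D1\<close>
  fits no component of a box, which forces the separate treatment of that case. When
  \<open>ln D1\<close> is below a threshold, the constants are so large that the claim is
  trivial.\<close>

lemma sum_alternating_Pow:
  assumes "finite X"
  shows "(\<Sum>A\<in>Pow X. (-1::real) ^ card A) = (if X = {} then 1 else 0)"
proof -
  have "(\<Sum>A\<in>Pow X. (-1::real) ^ card A) = (\<Prod>x\<in>X. (-1) + 1)"
    using prod_add[OF assms, of "\<lambda>_. -1::real" "\<lambda>_. 1"] by simp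
  thus ?thesis using assms by auto
qed

text \<open>Moebius inversion on the lattice of subsets: writing \<open>A = C \<union> D\<close>
  with \<open>D \<subseteq> B - C\<close> pulls out the sign of \<open>C\<close> and leaves the
  alternating sum over all subsets of \<open>B - C\<close>.\<close>

lemma sum_alternating_between:
  assumes "finite B" "C \<subseteq> B"
  shows "(\<Sum>A | C \<subseteq> A \<and> A \<subseteq> B. (-1::real) ^ card A) = (if B = C then (-1) ^ card C else 0)"
proof -
  have fC: "finite C" using assms finite_subset by blast
  have "(\<Sum>A | C \<subseteq> A \<and> A \<subseteq> B. (-1::real) ^ card A)
      = (\<Sum>D\<in>Pow (B - C). (-1) ^ card (C \<union> D))"
    by (rule sum.reindex_bij_witness[of _ "\<lambda>D. C \<union> D" "\<lambda>A. A - C"]) (use assms in \<open>auto simp: Un_absorb1\<close>)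
  also have "\<dots> = (\<Sum>D\<in>Pow (B - C). (-1) ^ card C * (-1) ^ card D)"
  proof (rule sum.cong)
    fix D assume D: "D \<in> Pow (B - C)"
    have "card (C \<union> D) = card C + card D"
      by (rule card_Un_disjoint) (use D assms fC finite_subset[of D "B - C"] in auto)
    thus "(-1::real) ^ card (C \<union> D) = (-1) ^ card C * (-1) ^ card D"
      by (simp add: power_add)
  qed simp
  also have "\<dots> = (-1) ^ card C * (\<Sum>D\<in>Pow (B - C). (-1) ^ card D)"
    by (simp add: sum_distrib_left)
  also have "\<dots> = (if B = C then (-1) ^ card C else 0)"
    using assms by (subst sum_alternating_Pow) auto
  finally show ?thesis .
qed

text \<open>Squarefree divisors are represented by their sets of prime factors, so that Moebius inversion
  becomes inclusion--exclusion over subsets.\<close>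

definition prime_sets :: "nat \<Rightarrow> nat set set" where
  "prime_sets R = {A. finite A \<and> (\<forall>p\<in>A. prime p) \<and> \<Prod>A \<le> R}"

text \<open>For a set of primes this is Euler's totient of the squarefree number
  \<open>\<Prod>A\<close>.\<close>

definition phi_prod :: "nat set \<Rightarrow> real" where
  "phi_prod A = (\<Prod>p\<in>A. real p - 1)"

text \<open>The classical sum of mu(d)^2 / phi(d) over d \<le> \<open>R\<close>.\<close>

definition selberg_sum :: "nat \<Rightarrow> real" where
  "selberg_sum R = (\<Sum>A\<in>prime_sets R. 1 / phi_prod A)"

text \<open>Selberg's optimal weights: with d = \<open>\<Prod>A\<close> this is mu(d) d times the
  sum of mu(e)^2 / phi(e) over the multiples e \<le> \<open>R\<close> of d, normalised so that d = 1
  has weight 1 when \<open>R \<ge> 1\<close>.\<close>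

definition selberg_weight :: "nat \<Rightarrow> nat set \<Rightarrow> real" where
  "selberg_weight R A =
     real (\<Prod>A) * (-1) ^ card A * (\<Sum>B | B \<in> prime_sets R \<and> A \<subseteq> B. 1 / phi_prod B) / selberg_sum R"

lemma prime_factors_Prod_primes:
  assumes "finite A" "\<forall>p\<in>A. prime (p::nat)"
  shows "prime_factors (\<Prod>A) = A"
  using assms
proof (induction A rule: finite_induct)
  case (insert x F)
  hence "\<Prod>F \<noteq> 0" by (metis not_prime_0 prod_zero_iff insertCI)
  with insert show ?case by (auto simp: prime_factors_product prime_prime_factors)
qed simp

lemma Prod_primes_dvd_iff:
  assumes "finite A" "\<forall>p\<in>A. prime (p::nat)"
  shows "\<Prod>A dvd n \<longleftrightarrow> (\<forall>p\<in>A. p dvd n)"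
proof
  assume *: "\<forall>p\<in>A. p dvd n"
  show "\<Prod>A dvd n"
    using assms *
  proof (induction A rule: finite_induct)
    case (insert x F)
    have "coprime x (\<Prod>F)"
      using insert by (intro prod_coprime_right) (auto intro!: primes_coprime)
    with insert show ?case by (auto intro: divides_mult)
  qed simp
qed (use assms dvd_prod_eqI dvd_trans dvd_prodI in metis)

lemma prime_sets_pos: "A \<in> prime_sets R \<Longrightarrow> \<Prod>A > 0"
  unfolding prime_sets_def by (auto intro!: prod_pos prime_gt_0_nat)

lemma prime_sets_subset:
  assumes "B \<in> prime_sets R" "A \<subseteq> B"
  shows "A \<in> prime_sets R"
proof -
  have "finite B" using assms by (auto simp: prime_sets_def)
  hence "\<Prod>A dvd \<Prod>B" using assms(2) by (rule prod_dvd_prod_subset)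
  hence "\<Prod>A \<le> \<Prod>B" using prime_sets_pos[OF assms(1)] by (rule dvd_imp_le)
  with assms show ?thesis by (auto simp: prime_sets_def intro: finite_subset)
qed

lemma inj_on_Prod_prime_sets: "inj_on (\<lambda>A. \<Prod>A) (prime_sets R)"
  by (rule inj_onI) (metis (mono_tags, lifting) mem_Collect_eq prime_factors_Prod_primes prime_sets_def)

lemma Prod_prime_sets_subset: "(\<lambda>A. \<Prod>A) ` prime_sets R \<subseteq> {1..R}"
  using prime_sets_pos by (auto simp: prime_sets_def Suc_le_eq)

lemma finite_prime_sets: "finite (prime_sets R)"
  using inj_on_Prod_prime_sets Prod_prime_sets_subset
  by (meson finite_atLeastAtMost finite_imageD finite_subset)

lemma card_prime_sets_le: "card (prime_sets R) \<le> R"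
  using card_inj_on_le[OF inj_on_Prod_prime_sets Prod_prime_sets_subset] by simp

lemma phi_prod_pos: "A \<in> prime_sets R \<Longrightarrow> phi_prod A > 0"
  unfolding phi_prod_def prime_sets_def by (auto intro!: prod_pos simp: prime_gt_Suc_0_nat)

lemma empty_in_prime_sets: "R \<ge> 1 \<Longrightarrow> {} \<in> prime_sets R"
  by (simp add: prime_sets_def)

lemma selberg_sum_ge_1:
  assumes "R \<ge> 1"
  shows "selberg_sum R \<ge> 1"
proof -
  have "1 / phi_prod {} \<le> selberg_sum R" unfolding selberg_sum_def
    by (rule member_le_sum[OF empty_in_prime_sets[OF assms]])
       (auto simp: finite_prime_sets dest!: phi_prod_pos)
  thus ?thesis by (simp add: phi_prod_def)
qed

lemma selberg_weight_empty: "R \<ge> 1 \<Longrightarrow> selberg_weight R {} = 1"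
  using selberg_sum_ge_1[of R] by (simp add: selberg_weight_def selberg_sum_def)

text \<open>The partial sum is at most the full one, which leaves the factor
  \<open>\<Prod>A\<close>. This crude bound costs \<open>R ^ 2\<close> in every remainder term of
  the sieve; taking for \<open>R\<close> a small power of the interval length absorbs it.\<close>

lemma abs_selberg_weight_le:
  assumes "R \<ge> 1" "A \<in> prime_sets R"
  shows "\<bar>selberg_weight R A\<bar> \<le> real R"
proof -
  have G: "selberg_sum R \<ge> 1" by (rule selberg_sum_ge_1[OF assms(1)])
  have le: "(\<Sum>B | B \<in> prime_sets R \<and> A \<subseteq> B. 1 / phi_prod B) \<le> selberg_sum R"
    unfolding selberg_sum_def
    by (rule sum_mono2) (auto simp: finite_prime_sets dest!: phi_prod_pos)
  have ge: "(\<Sum>B | B \<in> prime_sets R \<and> A \<subseteq> B. 1 / phi_prod B) \<ge> 0"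
    by (rule sum_nonneg) (auto dest!: phi_prod_pos)
  have "\<bar>selberg_weight R A\<bar>
      = real (\<Prod>A) * ((\<Sum>B | B \<in> prime_sets R \<and> A \<subseteq> B. 1 / phi_prod B) / selberg_sum R)"
    using G ge by (simp add: selberg_weight_def abs_mult power_abs del: of_nat_prod)
  also have "\<dots> \<le> real (\<Prod>A) * 1"
    by (rule mult_left_mono) (use G le in \<open>auto simp: field_simps simp del: of_nat_prod\<close>)
  also have "\<dots> \<le> real R" using assms(2) by (simp add: prime_sets_def del: of_nat_prod)
  finally show ?thesis .
qed

text \<open>These sums are the coordinates in which the quadratic form of the sieve is diagonal.
  Exchanging the summations leaves an alternating sum over all \<open>A\<close> between
  \<open>C\<close> and \<open>B\<close>, so only \<open>B = C\<close> survives.\<close>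

lemma selberg_weight_dual:
  assumes "R \<ge> 1" "C \<in> prime_sets R"
  shows "(\<Sum>A | A \<in> prime_sets R \<and> C \<subseteq> A. selberg_weight R A / real (\<Prod>A))
         = (-1) ^ card C / (phi_prod C * selberg_sum R)"
proof -
  let ?P = "prime_sets R"
  note fin = finite_prime_sets[of R]
  have "(\<Sum>A | A \<in> ?P \<and> C \<subseteq> A. selberg_weight R A / real (\<Prod>A))
      = (\<Sum>A | A \<in> ?P \<and> C \<subseteq> A. \<Sum>B | B \<in> ?P \<and> A \<subseteq> B. (-1) ^ card A / phi_prod B / selberg_sum R)"
  proof (rule sum.cong)
    fix A assume "A \<in> {A. A \<in> ?P \<and> C \<subseteq> A}"
    hence "real (\<Prod>A) > 0" using prime_sets_pos[of A R] by (simp del: of_nat_prod)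
    thus "selberg_weight R A / real (\<Prod>A)
        = (\<Sum>B | B \<in> ?P \<and> A \<subseteq> B. (-1) ^ card A / phi_prod B / selberg_sum R)"
      by (simp add: selberg_weight_def sum_distrib_left sum_divide_distrib del: of_nat_prod)
  qed simp
  also have "\<dots> = (\<Sum>B | B \<in> ?P \<and> C \<subseteq> B. \<Sum>A | C \<subseteq> A \<and> A \<subseteq> B. (-1) ^ card A / phi_prod B / selberg_sum R)"
    (is "?l = ?r")
  proof -
    have "?l = (\<Sum>A | A \<in> ?P \<and> C \<subseteq> A. \<Sum>B\<in>{B. B \<in> ?P \<and> C \<subseteq> B} \<inter> {B. A \<subseteq> B}. (-1) ^ card A / phi_prod B / selberg_sum R)"
      by (intro sum.cong) auto
    also have "\<dots> = (\<Sum>A | A \<in> ?P \<and> C \<subseteq> A. \<Sum>B | B \<in> ?P \<and> C \<subseteq> B. if A \<subseteq> B then (-1) ^ card A / phi_prod B / selberg_sum R else 0)"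
      by (rule sum.cong[OF refl], subst sum.inter_restrict) (auto simp: fin)
    also have "\<dots> = (\<Sum>B | B \<in> ?P \<and> C \<subseteq> B. \<Sum>A | A \<in> ?P \<and> C \<subseteq> A. if A \<subseteq> B then (-1) ^ card A / phi_prod B / selberg_sum R else 0)"
      by (rule sum.swap)
    also have "\<dots> = ?r"
    proof (rule sum.cong[OF refl])
      fix B assume "B \<in> {B. B \<in> ?P \<and> C \<subseteq> B}"
      hence *: "{A. (A \<in> ?P \<and> C \<subseteq> A) \<and> A \<subseteq> B} = {A. C \<subseteq> A \<and> A \<subseteq> B}"
        using prime_sets_subset by blast
      show "(\<Sum>A | A \<in> ?P \<and> C \<subseteq> A. if A \<subseteq> B then (-1) ^ card A / phi_prod B / selberg_sum R else 0)
          = (\<Sum>A | C \<subseteq> A \<and> A \<subseteq> B. (-1) ^ card A / phi_prod B / selberg_sum R)"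
        using fin *  by (subst sum.inter_filter[symmetric]) auto
    qed
    finally show ?thesis .
  qed
  also have "\<dots> = (\<Sum>B | B \<in> ?P \<and> C \<subseteq> B. if B = C then (-1) ^ card C / phi_prod C / selberg_sum R else 0)"
  proof (rule sum.cong[OF refl])
    fix B assume B: "B \<in> {B. B \<in> ?P \<and> C \<subseteq> B}"
    have "(\<Sum>A | C \<subseteq> A \<and> A \<subseteq> B. (-1) ^ card A / phi_prod B / selberg_sum R)
        = (\<Sum>A | C \<subseteq> A \<and> A \<subseteq> B. (-1) ^ card A) / phi_prod B / selberg_sum R"
      by (simp add: sum_divide_distrib)
    also have "\<dots> = (if B = C then (-1) ^ card C / phi_prod C / selberg_sum R else 0)"
      using B by (subst sum_alternating_between) (auto simp: prime_sets_def)
    finally show "(\<Sum>A | C \<subseteq> A \<and> A \<subseteq> B. (-1) ^ card A / phi_prod B / selberg_sum R)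
        = (if B = C then (-1) ^ card C / phi_prod C / selberg_sum R else 0)" .
  qed
  also have "\<dots> = (-1) ^ card C / (phi_prod C * selberg_sum R)"
    using fin assms by (subst sum.delta) auto
  finally show ?thesis .
qed

lemma Prod_Un_mult_Int_real:
  assumes "finite A" "finite B"
  shows "real (\<Prod>(A \<union> B)) * real (\<Prod>(A \<inter> B)) = real (\<Prod>A) * real (\<Prod>B)"
  using prod.union_inter[OF assms, of "\<lambda>p. p"] by (metis of_nat_mult)

text \<open>The identity n = sum of phi(d) over d dividing n, for n the gcd of
  \<open>\<Prod>A\<close> and \<open>\<Prod>B\<close>. It comes from expanding the product of
  \<open>(p - 1) + 1\<close>.\<close>

lemma Prod_Int_eq_sum_phi_prod:
  assumes "A \<in> prime_sets R" "B \<in> prime_sets R"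
  shows "real (\<Prod>(A \<inter> B)) = (\<Sum>C | C \<in> prime_sets R \<and> C \<subseteq> A \<and> C \<subseteq> B. phi_prod C)"
proof -
  have fin: "finite (A \<inter> B)" using assms by (auto simp: prime_sets_def)
  have "real (\<Prod>(A \<inter> B)) = (\<Prod>p\<in>A \<inter> B. (real p - 1) + 1)" by simp
  also have "\<dots> = (\<Sum>C\<in>Pow (A \<inter> B). phi_prod C)"
    using prod_add[OF fin, of "\<lambda>p. real p - 1" "\<lambda>_. 1"] by (simp add: phi_prod_def)
  also have "Pow (A \<inter> B) = {C. C \<in> prime_sets R \<and> C \<subseteq> A \<and> C \<subseteq> B}"
    using prime_sets_subset assms by blast
  finally show ?thesis .
qed

text \<open>An lcm is the product divided by the gcd. Expanding the gcd into totients turns the form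
  into a sum over \<open>C\<close> of \<open>phi_prod C\<close> times the square of the coordinate
  computed in \<open>selberg_weight_dual\<close>.\<close>

lemma selberg_quadratic_form:
  assumes "R \<ge> 1"
  shows "(\<Sum>A\<in>prime_sets R. \<Sum>B\<in>prime_sets R.
            selberg_weight R A * selberg_weight R B / real (\<Prod>(A \<union> B))) = 1 / selberg_sum R"
proof -
  let ?P = "prime_sets R" and ?l = "\<lambda>A. selberg_weight R A / real (\<Prod>A)"
  note fin = finite_prime_sets[of R]
  have G: "selberg_sum R \<ge> 1" by (rule selberg_sum_ge_1[OF assms(1)])
  have "(\<Sum>A\<in>?P. \<Sum>B\<in>?P. selberg_weight R A * selberg_weight R B / real (\<Prod>(A \<union> B)))
      = (\<Sum>A\<in>?P. \<Sum>B\<in>?P. \<Sum>C\<in>?P. phi_prod C * ((if C \<subseteq> A then ?l A else 0) * (if C \<subseteq> B then ?l B else 0)))"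
  proof (intro sum.cong refl)
    fix A B assume AB: "A \<in> ?P" "B \<in> ?P"
    have AU: "A \<union> B \<subseteq> UNIV" "finite A" "finite B" "\<forall>p\<in>A \<union> B. prime p"
      using AB by (auto simp: prime_sets_def)
    have pos: "real (\<Prod>A) > 0" "real (\<Prod>B) > 0" "real (\<Prod>(A \<union> B)) > 0"
      using prime_sets_pos AB AU by (auto intro!: prod_pos prime_gt_0_nat simp del: of_nat_prod)
    have "selberg_weight R A * selberg_weight R B / real (\<Prod>(A \<union> B))
        = ?l A * ?l B * real (\<Prod>(A \<inter> B))"
      using Prod_Un_mult_Int_real[OF AU(2,3)] pos by (simp add: field_simps del: of_nat_prod)
    also have "\<dots> = (\<Sum>C | C \<in> ?P \<and> (C \<subseteq> A \<and> C \<subseteq> B). phi_prod C * (?l A * ?l B))"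
      by (subst Prod_Int_eq_sum_phi_prod[OF AB]) (simp add: sum_distrib_left sum_divide_distrib mult_ac del: of_nat_prod)
    also have "\<dots> = (\<Sum>C\<in>?P. if C \<subseteq> A \<and> C \<subseteq> B then phi_prod C * (?l A * ?l B) else 0)"
      using fin by (subst sum.inter_filter[symmetric]) (auto simp del: of_nat_prod)
    also have "\<dots> = (\<Sum>C\<in>?P. phi_prod C * ((if C \<subseteq> A then ?l A else 0) * (if C \<subseteq> B then ?l B else 0)))"
      by (intro sum.cong) auto
    finally show "selberg_weight R A * selberg_weight R B / real (\<Prod>(A \<union> B)) = \<dots>" .
  qed
  also have "\<dots> = (\<Sum>A\<in>?P. \<Sum>C\<in>?P. \<Sum>B\<in>?P. phi_prod C * ((if C \<subseteq> A then ?l A else 0) * (if C \<subseteq> B then ?l B else 0)))"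
    by (intro sum.cong refl sum.swap)
  also have "\<dots> = (\<Sum>C\<in>?P. \<Sum>A\<in>?P. \<Sum>B\<in>?P. phi_prod C * ((if C \<subseteq> A then ?l A else 0) * (if C \<subseteq> B then ?l B else 0)))"
    by (rule sum.swap)
  also have "\<dots> = (\<Sum>C\<in>?P. phi_prod C * ((\<Sum>A\<in>?P. if C \<subseteq> A then ?l A else 0) * (\<Sum>B\<in>?P. if C \<subseteq> B then ?l B else 0)))"
    by (intro sum.cong refl, subst sum_product) (simp only: sum_distrib_left)
  also have "\<dots> = (\<Sum>C\<in>?P. phi_prod C * ((-1) ^ card C / (phi_prod C * selberg_sum R)) ^ 2)"
  proof (intro sum.cong refl)
    fix C assume C: "C \<in> ?P"
    have "(\<Sum>A\<in>?P. if C \<subseteq> A then ?l A else 0) = (-1) ^ card C / (phi_prod C * selberg_sum R)"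
      using fin selberg_weight_dual[OF assms C] by (subst sum.inter_filter[symmetric]) (auto simp del: of_nat_prod)
    thus "phi_prod C * ((\<Sum>A\<in>?P. if C \<subseteq> A then ?l A else 0) * (\<Sum>B\<in>?P. if C \<subseteq> B then ?l B else 0))
       = phi_prod C * ((-1) ^ card C / (phi_prod C * selberg_sum R)) ^ 2"
      by (simp add: power2_eq_square del: of_nat_prod)
  qed
  also have "\<dots> = (\<Sum>C\<in>?P. 1 / phi_prod C * (1 / selberg_sum R ^ 2))"
  proof (intro sum.cong refl)
    fix C assume C: "C \<in> ?P"
    have "((-1::real) ^ card C) ^ 2 = 1" by (simp flip: power_mult)
    thus "phi_prod C * ((-1) ^ card C / (phi_prod C * selberg_sum R)) ^ 2 = 1 / phi_prod C * (1 / selberg_sum R ^ 2)"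
      using phi_prod_pos[OF C] G by (simp add: power_divide power_mult_distrib power2_eq_square)
  qed
  also have "\<dots> = selberg_sum R * (1 / selberg_sum R ^ 2)"
    unfolding selberg_sum_def by (simp only: sum_distrib_right)
  also have "\<dots> = 1 / selberg_sum R" using G by (simp add: power2_eq_square)
  finally show ?thesis .
qed

section \<open>Sieving an interval of integers\<close>

lemma card_multiples_half_open:
  fixes u y :: real
  assumes "m \<ge> 1" "u \<ge> 0" "y \<ge> 0"
  shows "\<bar>real (card {n::nat. u \<le> real n \<and> real n < u + y \<and> m dvd n}) - y / real m\<bar> \<le> 1"
proof -
  define a b where "a = nat \<lceil>u / m\<rceil>" and "b = nat \<lceil>(u + y) / m\<rceil>"
  have a: "k \<ge> a \<longleftrightarrow> u \<le> real m * real k" for k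
    using assms by (simp add: a_def ceiling_le_iff divide_le_eq mult_ac nat_le_iff)
  have b: "k < b \<longleftrightarrow> real m * real k < u + y" for k
  proof -
    have "k < b \<longleftrightarrow> int k < \<lceil>(u + y) / m\<rceil>" by (simp add: b_def zless_nat_eq_int_zless)
    also have "\<dots> \<longleftrightarrow> real k < (u + y) / m" by (simp add: less_ceiling_iff)
    also have "\<dots> \<longleftrightarrow> real m * real k < u + y" using assms by (simp add: less_divide_eq mult_ac)
    finally show ?thesis .
  qed
  have "{n::nat. u \<le> real n \<and> real n < u + y \<and> m dvd n} = (\<lambda>k. m * k) ` {a..<b}"
    by (auto simp: a b dvd_def)
  also have "card \<dots> = b - a" using assms by (subst card_image) (auto simp: inj_on_def)
  finally have c: "card {n::nat. u \<le> real n \<and> real n < u + y \<and> m dvd n} = b - a" .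
  have ab: "a \<le> b" unfolding a_def b_def using assms by (intro nat_mono ceiling_mono divide_right_mono) auto
  have "real a \<ge> u / m" "real a < u / m + 1" "real b \<ge> (u + y) / m" "real b < (u + y) / m + 1"
    unfolding a_def b_def using assms ceiling_correct[of "u / m"] ceiling_correct[of "(u + y) / m"] by auto
  hence "\<bar>real b - real a - y / m\<bar> \<le> 1" by (simp add: add_divide_distrib abs_le_iff)
  thus ?thesis using c ab by (simp add: of_nat_diff)
qed

lemma sum_power_inverse_le:
  assumes "p > (1::real)"
  shows "(\<Sum>e=1..R. (1 / p) ^ e) \<le> 1 / (p - 1)"
proof -
  have "(\<Sum>e=1..R. (1 / p) ^ e) = (1 - (1 / p) ^ R) / (p - 1)"
  proof (induction R)
    case (Suc R)
    define z where "z = (1 / p) ^ Suc R"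
    have "(1 / p) ^ R = p * z" using assms by (simp add: z_def)
    hence "(\<Sum>e=1..Suc R. (1 / p) ^ e) = (1 - p * z) / (p - 1) + z"
      using Suc by (simp add: z_def)
    also have "\<dots> = (1 - z) / (p - 1)" using assms by (simp add: field_simps)
    finally show ?case by (simp add: z_def)
  qed simp
  also have "\<dots> \<le> 1 / (p - 1)" using assms by (intro divide_right_mono) auto
  finally show ?thesis .
qed

lemma prime_factors_in_prime_sets:
  assumes "n > 0" "n \<le> R"
  shows "prime_factors n \<in> prime_sets R"
proof -
  have "\<Prod>(prime_factors n) dvd n"
    by (subst Prod_primes_dvd_iff) (auto simp: in_prime_factors_iff)
  hence "\<Prod>(prime_factors n) \<le> R" using assms dvd_imp_le le_trans by blast
  thus ?thesis by (auto simp: prime_sets_def)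
qed

text \<open>Such an \<open>n\<close> is determined by its exponents, all at least 1, so the sum is
  bounded by the product over \<open>p \<in> A\<close> of 1/p + 1/p^2 + ... = 1/(p - 1). Cutting the
  exponents off at \<open>R\<close> keeps everything finite and loses nothing, because an exponent e
  satisfies e < 2^e \<le> n \<le> R.\<close>

lemma sum_inverse_prime_factors_eq_le:
  assumes "A \<in> prime_sets R"
  shows "(\<Sum>n | n \<in> {1..R} \<and> prime_factors n = A. 1 / real n) \<le> 1 / phi_prod A"
proof -
  let ?N = "{n. n \<in> {1..R} \<and> prime_factors n = A}"
  let ?m = "\<lambda>n. restrict (\<lambda>p. multiplicity p n) A"
  have A: "finite A" "\<And>p. p \<in> A \<Longrightarrow> prime p" using assms by (auto simp: prime_sets_def)
  have fact: "n = (\<Prod>p\<in>A. p ^ ?m n p)" if "n \<in> ?N" for n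
  proof -
    have "n = (\<Prod>p\<in>prime_factors n. p ^ multiplicity p n)"
      using that by (intro prime_factorization_nat) auto
    also have "\<dots> = (\<Prod>p\<in>A. p ^ ?m n p)" using that by (intro prod.cong) auto
    finally show ?thesis .
  qed
  have inj: "inj_on ?m ?N" by (rule inj_onI) (metis fact)
  have m: "?m ` ?N \<subseteq> PiE A (\<lambda>_. {1..R})"
  proof (clarify)
    fix n assume n: "n \<in> {1..R}" "A = prime_factors n"
    show "restrict (\<lambda>p. multiplicity p n) (prime_factors n) \<in> PiE (prime_factors n) (\<lambda>_. {1..R})"
    proof (rule restrict_PiE_iff[THEN iffD2], rule ballI)
      fix p assume p: "p \<in> prime_factors n"
      have "2 ^ multiplicity p n \<le> p ^ multiplicity p n"
        using p by (intro power_mono) (auto simp: in_prime_factors_iff prime_ge_2_nat)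
      also have "\<dots> \<le> n" using n by (intro dvd_imp_le multiplicity_dvd) auto
      finally have "2 ^ multiplicity p n \<le> n" .
      moreover have "multiplicity p n < 2 ^ multiplicity p n" by (rule less_exp)
      moreover have "multiplicity p n > 0" using p by (simp add: prime_factors_multiplicity)
      ultimately show "multiplicity p n \<in> {1..R}" using n unfolding atLeastAtMost_iff by linarith
    qed
  qed
  have "(\<Sum>n\<in>?N. 1 / real n) = (\<Sum>n\<in>?N. \<Prod>p\<in>A. (1 / real p) ^ ?m n p)"
  proof (rule sum.cong[OF refl])
    fix n assume n: "n \<in> ?N"
    have "1 / real n = 1 / real (\<Prod>p\<in>A. p ^ ?m n p)" using fact[OF n] by simp
    also have "\<dots> = (\<Prod>p\<in>A. (1 / real p) ^ ?m n p)"
      by (simp add: prod_dividef power_divide)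
    finally show "1 / real n = \<dots>" .
  qed
  also have "\<dots> = (\<Sum>g\<in>?m ` ?N. \<Prod>p\<in>A. (1 / real p) ^ g p)"
    using inj by (subst sum.reindex) auto
  also have "\<dots> \<le> (\<Sum>g\<in>PiE A (\<lambda>_. {1..R}). \<Prod>p\<in>A. (1 / real p) ^ g p)"
    using m A by (intro sum_mono2) (auto intro!: finite_PiE prod_nonneg)
  also have "\<dots> = (\<Prod>p\<in>A. \<Sum>e=1..R. (1 / real p) ^ e)"
    using A by (subst prod_sum_PiE) auto
  also have "\<dots> \<le> (\<Prod>p\<in>A. 1 / (real p - 1))"
    using A by (intro prod_mono conjI sum_nonneg sum_power_inverse_le) (auto simp: prime_gt_Suc_0_nat)
  also have "\<dots> = 1 / phi_prod A" by (simp add: phi_prod_def prod_dividef)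
  finally show ?thesis .
qed

text \<open>When the harmonic sum up to \<open>R\<close> is grouped by the set of prime factors,
  each group is bounded by one term of \<open>selberg_sum\<close>.\<close>

lemma selberg_sum_ge_ln: "ln (real R + 1) \<le> selberg_sum R"
proof -
  have "ln (real R + 1) \<le> (\<Sum>n\<in>{1..R}. 1 / real n)"
    using ln_le_harm[of R] by (simp add: harm_def inverse_eq_divide)
  also have "\<dots> = (\<Sum>A\<in>prime_sets R. \<Sum>n | n \<in> {1..R} \<and> prime_factors n = A. 1 / real n)"
    by (rule sum.group[symmetric]) (auto simp: finite_prime_sets intro!: prime_factors_in_prime_sets)
  also have "\<dots> \<le> selberg_sum R"
    unfolding selberg_sum_def by (intro sum_mono sum_inverse_prime_factors_eq_le)
  finally show ?thesis .
qed

text \<open>By \<open>R < q\<close> no prime occurring in \<open>prime_sets R\<close> divides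
  \<open>q\<close>, so the squared divisor sum \<open>w q ^ 2\<close> is 1 at these primes and
  nonnegative elsewhere. The remainder comes from at most \<open>R ^ 2\<close> pairs of sets, each
  with error at most \<open>R ^ 2\<close>.\<close>

lemma selberg_sieve:
  assumes R: "R \<ge> 1" and u: "u \<ge> 0" and y: "y \<ge> (0::real)"
  shows "real (card {q. prime q \<and> u \<le> real q \<and> real q < u + y \<and> R < q})
           \<le> y / selberg_sum R + real R ^ 4"
proof -
  let ?P = "prime_sets R" and ?l = "selberg_weight R"
  define I where "I = {n::nat. u \<le> real n \<and> real n < u + y}"
  define Q where "Q = {q. prime q \<and> u \<le> real q \<and> real q < u + y \<and> R < q}"
  have finI: "finite I"
    by (rule finite_subset[of _ "{..nat \<lceil>u + y\<rceil>}"]) (auto simp: I_def le_nat_iff, linarith)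
  note finP = finite_prime_sets[of R]
  define c where "c = (\<lambda>(n::nat) (A::nat set). if \<forall>p\<in>A. p dvd n then 1 else (0::real))"
  define w where "w = (\<lambda>n. \<Sum>A\<in>?P. ?l A * c n A)"
  have w1: "w q = 1" if "q \<in> Q" for q
  proof -
    have "c q A = (if A = {} then 1 else 0)" if A: "A \<in> ?P" for A
    proof (cases "A = {}")
      case False
      then obtain p where p: "p \<in> A" by auto
      have "p dvd \<Prod>A" using A p by (intro dvd_prodI) (auto simp: prime_sets_def)
      hence "p \<le> R" using prime_sets_pos[OF A] A dvd_imp_le[of p "\<Prod>A"] by (auto simp: prime_sets_def)
      hence "\<not> p dvd q" using p A \<open>q \<in> Q\<close> primes_dvd_imp_eq[of p q] by (auto simp: prime_sets_def Q_def)
      thus ?thesis using False p by (auto simp: c_def)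
    qed (simp add: c_def)
    hence "w q = (\<Sum>A\<in>?P. if A = {} then ?l {} else 0)"
      unfolding w_def by (intro sum.cong) auto
    also have "\<dots> = 1" using finP empty_in_prime_sets[OF R] selberg_weight_empty[OF R] by (subst sum.delta) auto
    finally show ?thesis .
  qed
  have "real (card Q) = (\<Sum>q\<in>Q. w q ^ 2)" using w1 by simp
  also have "\<dots> \<le> (\<Sum>n\<in>I. w n ^ 2)"
    using finI by (intro sum_mono2) (auto simp: Q_def I_def)
  also have "\<dots> = (\<Sum>n\<in>I. \<Sum>A\<in>?P. \<Sum>B\<in>?P. ?l A * ?l B * c n (A \<union> B))"
    unfolding w_def power2_eq_square sum_product
    by (intro sum.cong refl) (auto simp: c_def)
  also have "\<dots> = (\<Sum>A\<in>?P. \<Sum>B\<in>?P. \<Sum>n\<in>I. ?l A * ?l B * c n (A \<union> B))"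
    by (subst sum.swap, intro sum.cong refl, rule sum.swap)
  also have "\<dots> = (\<Sum>A\<in>?P. \<Sum>B\<in>?P. ?l A * ?l B * (\<Sum>n\<in>I. c n (A \<union> B)))"
    by (simp add: sum_distrib_left)
  also have "\<dots> \<le> (\<Sum>A\<in>?P. \<Sum>B\<in>?P. y * (?l A * ?l B / real (\<Prod>(A \<union> B))) + real R * real R)"
  proof (intro sum_mono)
    fix A B assume AB: "A \<in> ?P" "B \<in> ?P"
    have AU: "finite (A \<union> B)" "\<forall>p\<in>A \<union> B. prime p"
      using AB by (auto simp: prime_sets_def)
    have "\<Prod>(A \<union> B) > 0"
      using AU by (intro prod_pos) (auto intro: prime_gt_0_nat)
    hence pos: "\<Prod>(A \<union> B) \<ge> 1" by simp
    have "(\<Sum>n\<in>I. c n (A \<union> B)) = real (card {n. u \<le> real n \<and> real n < u + y \<and> \<Prod>(A \<union> B) dvd n})"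
      unfolding c_def Prod_primes_dvd_iff[OF AU] using finI
      by (subst sum.inter_filter[symmetric]) (auto simp: I_def conj_assoc)
    hence "\<bar>(\<Sum>n\<in>I. c n (A \<union> B)) - y / real (\<Prod>(A \<union> B))\<bar> \<le> 1"
      using card_multiples_half_open[OF pos u y] by (simp del: of_nat_prod)
    hence "\<bar>?l A\<bar> * \<bar>?l B\<bar> * \<bar>(\<Sum>n\<in>I. c n (A \<union> B)) - y / real (\<Prod>(A \<union> B))\<bar> \<le> real R * real R * 1"
      using abs_selberg_weight_le[OF R AB(1)] abs_selberg_weight_le[OF R AB(2)]
      by (intro mult_mono mult_nonneg_nonneg abs_ge_zero) simp_all
    hence "\<bar>(?l A * ?l B) * ((\<Sum>n\<in>I. c n (A \<union> B)) - y / real (\<Prod>(A \<union> B)))\<bar> \<le> real R * real R"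
      by (simp only: abs_mult mult_1_right)
    hence "(?l A * ?l B) * ((\<Sum>n\<in>I. c n (A \<union> B)) - y / real (\<Prod>(A \<union> B))) \<le> real R * real R"
      by (rule order.trans[OF abs_ge_self])
    thus "?l A * ?l B * (\<Sum>n\<in>I. c n (A \<union> B))
        \<le> y * (?l A * ?l B / real (\<Prod>(A \<union> B))) + real R * real R"
      by (simp add: algebra_simps del: of_nat_prod)
  qed
  also have "\<dots> = y * (1 / selberg_sum R) + real (card ?P) * (real (card ?P) * (real R * real R))"
    by (simp add: sum.distrib selberg_quadratic_form[OF R, symmetric] sum_distrib_left del: of_nat_prod)
  also have "\<dots> \<le> y / selberg_sum R + real R * (real R * (real R * real R))"
    using card_prime_sets_le[of R] by (intro add_mono mult_mono) auto
  finally show ?thesis by (simp add: Q_def power4_eq_xxxx mult.assoc)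
qed

text \<open>The threshold \<open>y0\<close> does not depend on \<open>u\<close>: the intervals
  sieved later are shorter than their position by a factor \<open>ln D1\<close>.\<close>

lemma brun_titchmarsh:
  "\<exists>y0. \<forall>u\<ge>0. \<forall>y\<ge>y0. real (card {q. prime q \<and> u \<le> real q \<and> real q < u + y}) \<le> 13 * y / ln y"
proof -
  have "eventually (\<lambda>y::real. 12 * y / ln y + y powr (1/3) + y powr (1/12) \<le> 13 * y / ln y \<and> y > 1) at_top"
    by (intro eventually_conj) real_asymp+
  then obtain y0 where y0: "\<And>y::real. y \<ge> y0 \<Longrightarrow> 12 * y / ln y + y powr (1/3) + y powr (1/12) \<le> 13 * y / ln y \<and> y > 1"
    unfolding eventually_at_top_linorder by blast
  show ?thesis
  proof (rule exI[of _ y0], intro allI impI)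
    fix u y :: real assume u: "u \<ge> 0" and "y \<ge> y0"
    note y = y0[OF \<open>y \<ge> y0\<close>]
    \<comment> \<open>With level y^(1/12) the remainder \<open>R ^ 4\<close> is at most y^(1/3) and
      the main term is 12 y / ln y. The constant 13 leaves room for that remainder and for the
      primes up to \<open>R\<close>.\<close>
    define R where "R = nat \<lfloor>y powr (1/12)\<rfloor>"
    have R: "R \<ge> 1" "real R \<le> y powr (1/12)" "y powr (1/12) \<le> real R + 1"
      using y ge_one_powr_ge_zero[of y "1/12"] by (auto simp: R_def le_nat_iff)
    let ?Q = "{q. prime q \<and> u \<le> real q \<and> real q < u + y}"
    let ?Q1 = "{q. prime q \<and> u \<le> real q \<and> real q < u + y \<and> R < q}"
    have fin1: "finite ?Q1"
      by (rule finite_subset[of _ "{..nat \<lceil>u + y\<rceil>}"]) (auto simp: le_nat_iff, linarith)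
    have "card ?Q \<le> card (?Q1 \<union> {1..R})"
      using fin1 by (intro card_mono) (auto simp: Suc_le_eq prime_gt_0_nat)
    also have "\<dots> \<le> card ?Q1 + card {1..R}" by (rule card_Un_le)
    finally have "real (card ?Q) \<le> real (card ?Q1) + real R" by simp
    also have "real (card ?Q1) \<le> y / selberg_sum R + real R ^ 4"
      using y by (intro selberg_sieve R u) auto
    also have "y / selberg_sum R \<le> y / (ln y / 12)"
    proof (intro divide_left_mono mult_pos_pos)
      have "ln y / 12 = ln (y powr (1/12))" using y by (simp add: ln_powr)
      also have "\<dots> \<le> ln (real R + 1)" using R y by (intro ln_mono) auto
      also have "\<dots> \<le> selberg_sum R" by (rule selberg_sum_ge_ln)
      finally show "ln y / 12 \<le> selberg_sum R" .
    qed (use y selberg_sum_ge_1[OF R(1)] in auto)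
    also have "real R ^ 4 \<le> (y powr (1/12)) ^ 4" using R by (intro power_mono) auto
    also have "(y powr (1/12)) ^ 4 = y powr (1/3)" using y by (simp add: powr_powr flip: powr_realpow)
    finally show "real (card ?Q) \<le> 13 * y / ln y" using y R by simp
  qed
qed

section \<open>A Chebyshev bound for primes congruent to 1 modulo 4\<close>

text \<open>The logarithm is the Dirichlet convolution of the von Mangoldt function with 1. The
  range of \<open>d\<close> ends at \<open>X\<close> rather than \<open>Y\<close> so that the sums
  for several \<open>Y = X div k\<close> can be combined term by term; terms with
  \<open>d > Y\<close> vanish.\<close>

lemma sum_ln_eq_sum_mangoldt:
  assumes "Y \<le> X"
  shows "(\<Sum>n | n \<in> {1..Y} \<and> Q n. ln (real n))
       = (\<Sum>d=1..X. mangoldt d * real (card {k. k \<in> {1..Y div d} \<and> Q (k * d)}))"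
proof -
  have "(\<Sum>n | n \<in> {1..Y} \<and> Q n. ln (real n))
      = (\<Sum>n | n \<in> {1..Y} \<and> Q n. \<Sum>d=1..X. if d dvd n then mangoldt d else 0)"
  proof (rule sum.cong[OF refl])
    fix n assume n: "n \<in> {n. n \<in> {1..Y} \<and> Q n}"
    hence "ln (real n) = (\<Sum>d | d dvd n. mangoldt d)" by (subst mangoldt_sum) auto
    also have "{d. d dvd n} = {d \<in> {1..X}. d dvd n}"
      using n assms dvd_imp_le[of _ n] by (auto simp: Suc_le_eq intro!: Nat.gr0I) fastforce
    also have "(\<Sum>d\<in>\<dots>. mangoldt d) = (\<Sum>d=1..X. if d dvd n then mangoldt d else (0::real))"
      by (rule sum.inter_filter) simp
    finally show "ln (real n) = \<dots>" .
  qed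
  also have "\<dots> = (\<Sum>d=1..X. \<Sum>n | n \<in> {1..Y} \<and> Q n. if d dvd n then mangoldt d else 0)"
    by (rule sum.swap)
  also have "\<dots> = (\<Sum>d=1..X. mangoldt d * real (card {k. k \<in> {1..Y div d} \<and> Q (k * d)}))"
  proof (rule sum.cong[OF refl])
    fix d assume d: "d \<in> {1..X}"
    have "(\<Sum>n | n \<in> {1..Y} \<and> Q n. if d dvd n then mangoldt d else (0::real))
        = (\<Sum>n\<in>{n\<in>{n. n \<in> {1..Y} \<and> Q n}. d dvd n}. mangoldt d)"
      by (rule sum.inter_filter[symmetric]) simp
    also have "{n\<in>{n. n \<in> {1..Y} \<and> Q n}. d dvd n} = (\<lambda>k. k * d) ` {k. k \<in> {1..Y div d} \<and> Q (k * d)}"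
      using d by (auto simp: dvd_def mult.commute less_eq_div_iff_mult_less_eq image_iff)
    also have "(\<Sum>n\<in>\<dots>. mangoldt d) = mangoldt d * real (card {k. k \<in> {1..Y div d} \<and> Q (k * d)})"
      using d by (simp add: card_image inj_on_def)
    finally show "(\<Sum>n | n \<in> {1..Y} \<and> Q n. if d dvd n then mangoldt d else (0::real)) = \<dots>" .
  qed
  finally show ?thesis .
qed

section \<open>Logarithm sums over residue classes modulo 4\<close>

lemma nat_mod_4_exhaust:
  obtains m r :: nat where "t = r + 4 * m" "r \<in> {0,1,2,3}"
proof (rule that)
  show "t = t mod 4 + 4 * (t div 4)" by simp
  have "t mod 4 < 4" by simp
  thus "t mod 4 \<in> {0,1,2,3}" by (simp, linarith)
qed

lemma odd_iff_mod_4: "odd (n::nat) \<longleftrightarrow> n mod 4 = 1 \<or> n mod 4 = 3"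
  by (rule nat_mod_4_exhaust[of n]) auto

lemma card_residue_1_mod_4: "card {k. k \<in> {1..t} \<and> k mod 4 = 1} = (t + 3) div 4"
proof (induction t)
  case (Suc t)
  have *: "(Suc t + 3) div 4 = (if Suc t mod 4 = 1 then Suc ((t + 3) div 4) else (t + 3) div 4)"
  proof -
    obtain m r where "t = r + 4 * m" "r \<in> {0,1,2,3}" by (rule nat_mod_4_exhaust)
    moreover from this have "(r + 4 * m + 3) div 4 = (r + 3) div 4 + m"
      "(Suc (r + 4 * m) + 3) div 4 = (Suc r + 3) div 4 + m" "Suc (r + 4 * m) mod 4 = Suc r mod 4"
      by auto
    ultimately show ?thesis by auto
  qed
  have S: "{k. k \<in> {1..Suc t} \<and> k mod 4 = 1}
      = (if Suc t mod 4 = 1 then insert (Suc t) {k. k \<in> {1..t} \<and> k mod 4 = 1}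
         else {k. k \<in> {1..t} \<and> k mod 4 = 1})"
    by (auto simp: le_Suc_eq)
  have "card {k. k \<in> {1..Suc t} \<and> k mod 4 = 1} = (if Suc t mod 4 = 1 then Suc (card {k. k \<in> {1..t} \<and> k mod 4 = 1})
      else card {k. k \<in> {1..t} \<and> k mod 4 = 1})"
    unfolding S by simp
  also have "\<dots> = (Suc t + 3) div 4" unfolding Suc.IH by (rule *[symmetric])
  finally show ?case .
qed simp

lemma card_residue_3_mod_4: "card {k. k \<in> {1..t} \<and> k mod 4 = 3} = (t + 1) div 4"
proof (induction t)
  case (Suc t)
  have *: "(Suc t + 1) div 4 = (if Suc t mod 4 = 3 then Suc ((t + 1) div 4) else (t + 1) div 4)"
  proof -
    obtain m r where "t = r + 4 * m" "r \<in> {0,1,2,3}" by (rule nat_mod_4_exhaust)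
    moreover from this have "(r + 4 * m + 1) div 4 = (r + 1) div 4 + m"
      "(Suc (r + 4 * m) + 1) div 4 = (Suc r + 1) div 4 + m" "Suc (r + 4 * m) mod 4 = Suc r mod 4"
      by auto
    ultimately show ?thesis by auto
  qed
  have S: "{k. k \<in> {1..Suc t} \<and> k mod 4 = 3}
      = (if Suc t mod 4 = 3 then insert (Suc t) {k. k \<in> {1..t} \<and> k mod 4 = 3}
         else {k. k \<in> {1..t} \<and> k mod 4 = 3})"
    by (auto simp: le_Suc_eq)
  have "card {k. k \<in> {1..Suc t} \<and> k mod 4 = 3} = (if Suc t mod 4 = 3 then Suc (card {k. k \<in> {1..t} \<and> k mod 4 = 3})
      else card {k. k \<in> {1..t} \<and> k mod 4 = 3})"
    unfolding S by simp
  also have "\<dots> = (Suc t + 1) div 4" unfolding Suc.IH by (rule *[symmetric])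
  finally show ?case .
qed simp

definition log_sum_residue :: "nat \<Rightarrow> nat \<Rightarrow> real" where
  "log_sum_residue a Y = (\<Sum>n | n \<in> {1..Y} \<and> n mod 4 = a. ln (real n))"

text \<open>An odd \<open>d\<close> is its own inverse modulo 4, so \<open>k * d\<close> is in class
  1 exactly when \<open>k\<close> and \<open>d\<close> are in the same class; for even
  \<open>d\<close> this never happens.\<close>

lemma log_sum_residue_1_eq:
  assumes "Y \<le> X"
  shows "log_sum_residue 1 Y = (\<Sum>d=1..X. mangoldt d *
     (if d mod 4 = 1 then real ((Y div d + 3) div 4)
      else if d mod 4 = 3 then real ((Y div d + 1) div 4) else 0))"
  unfolding log_sum_residue_def sum_ln_eq_sum_mangoldt[OF assms]
proof (rule sum.cong[OF refl])
  fix d :: nat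
  have e: "k * d mod 4 = (d mod 4 * k) mod 4" for k
    by (metis mod_mult_left_eq mult.commute)
  have "k * d mod 4 = 1 \<longleftrightarrow> k mod 4 = 1" if "d mod 4 = 1" for k
    unfolding e that by simp
  moreover have "k * d mod 4 = 1 \<longleftrightarrow> k mod 4 = 3" if "d mod 4 = 3" for k
    unfolding e that by presburger
  moreover have "k * d mod 4 \<noteq> 1" if "d mod 4 \<noteq> 1" "d mod 4 \<noteq> 3" for k
  proof -
    have "even d" using that odd_iff_mod_4[of d] by blast
    hence "even (k * d)" by simp
    thus ?thesis by (metis odd_iff_mod_4)
  qed
  ultimately have "real (card {k. k \<in> {1..Y div d} \<and> k * d mod 4 = 1})
    = (if d mod 4 = 1 then real ((Y div d + 3) div 4)
      else if d mod 4 = 3 then real ((Y div d + 1) div 4) else 0)"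
    using card_residue_1_mod_4[of "Y div d"] card_residue_3_mod_4[of "Y div d"] by simp
  thus "mangoldt d * real (card {k. k \<in> {1..Y div d} \<and> k * d mod 4 = 1})
    = mangoldt d * (if d mod 4 = 1 then real ((Y div d + 3) div 4)
      else if d mod 4 = 3 then real ((Y div d + 1) div 4) else 0)"
    by (simp only:)
qed

lemma log_sum_residue_3_eq:
  assumes "Y \<le> X"
  shows "log_sum_residue 3 Y = (\<Sum>d=1..X. mangoldt d *
     (if d mod 4 = 1 then real ((Y div d + 1) div 4)
      else if d mod 4 = 3 then real ((Y div d + 3) div 4) else 0))"
  unfolding log_sum_residue_def sum_ln_eq_sum_mangoldt[OF assms]
proof (rule sum.cong[OF refl])
  fix d :: nat
  have e: "k * d mod 4 = (d mod 4 * k) mod 4" for k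
    by (metis mod_mult_left_eq mult.commute)
  have "k * d mod 4 = 3 \<longleftrightarrow> k mod 4 = 3" if "d mod 4 = 1" for k
    unfolding e that by simp
  moreover have "k * d mod 4 = 3 \<longleftrightarrow> k mod 4 = 1" if "d mod 4 = 3" for k
    unfolding e that by presburger
  moreover have "k * d mod 4 \<noteq> 3" if "d mod 4 \<noteq> 1" "d mod 4 \<noteq> 3" for k
  proof -
    have "even d" using that odd_iff_mod_4[of d] by blast
    hence "even (k * d)" by simp
    thus ?thesis by (metis odd_iff_mod_4)
  qed
  ultimately have "real (card {k. k \<in> {1..Y div d} \<and> k * d mod 4 = 3})
    = (if d mod 4 = 1 then real ((Y div d + 1) div 4)
      else if d mod 4 = 3 then real ((Y div d + 3) div 4) else 0)"
    using card_residue_1_mod_4[of "Y div d"] card_residue_3_mod_4[of "Y div d"] by simp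
  thus "mangoldt d * real (card {k. k \<in> {1..Y div d} \<and> k * d mod 4 = 3})
    = mangoldt d * (if d mod 4 = 1 then real ((Y div d + 1) div 4)
      else if d mod 4 = 3 then real ((Y div d + 3) div 4) else 0)"
    by (simp only:)
qed

text \<open>
  The coefficients belong to $A_1(x) - A_1(x/2) - \frac{1}{2} A_1(x/3) - A_3(x/3)$, where
  $A_a(x) = \sum_{n \le x,\, n \equiv a (4)} \log n$, and were found by linear programming: the
  main term $\frac{\log 6}{8} x$ exceeds the cost $\frac{1}{2}\psi(x/5) + \frac{1}{2}\psi(x/17)$ of
  the positive parts at $t \ge 5$ and $t \ge 17$ once $\psi(x) \le \frac{3}{2} x + O(1)$.
  Both step functions have period 24.
\<close>

lemma step_function_1_bound:
  fixes t :: nat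
  shows "2 * ((t + 3) div 4) \<le> 2 * ((t div 2 + 3) div 4) + (t div 3 + 3) div 4 + 2 * ((t div 3 + 1) div 4)
     + (if t = 1 then 2 else 0) + (if 5 \<le> t then 1 else 0) + (if 17 \<le> t then 1 else 0)"
proof -
  define m r where "m = t div 24" and "r = t mod 24"
  have t: "t = r + 24 * m" by (simp add: m_def r_def)
  have "r < 24" by (simp add: r_def)
  hence r: "r \<in> {0,1,2,3,4,5,6,7,8,9,10,11,12,13,14,15,16,17,18,19,20,21,22,23}" by (simp, arith)
  \<comment> \<open>Raising \<open>t\<close> by 24 adds 12 to both sides apart from the indicator
    terms, since 1 = 1/2 + 1/6 + 1/3. So 24 residues remain to be checked.\<close>
  have *: "(r + 24 * m + 3) div 4 = (r + 3) div 4 + 6 * m"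
     "((r + 24 * m) div 2 + 3) div 4 = (r div 2 + 3) div 4 + 3 * m"
     "((r + 24 * m) div 3 + 3) div 4 = (r div 3 + 3) div 4 + 2 * m"
     "((r + 24 * m) div 3 + 1) div 4 = (r div 3 + 1) div 4 + 2 * m" by auto
  show ?thesis unfolding t * using r by auto
qed

lemma step_function_3_bound:
  fixes t :: nat
  shows "2 * ((t + 1) div 4) \<le> 2 * ((t div 2 + 1) div 4) + (t div 3 + 1) div 4 + 2 * ((t div 3 + 3) div 4)
     + (if 5 \<le> t then 1 else 0)"
proof -
  define m r where "m = t div 24" and "r = t mod 24"
  have t: "t = r + 24 * m" by (simp add: m_def r_def)
  have "r < 24" by (simp add: r_def)
  hence r: "r \<in> {0,1,2,3,4,5,6,7,8,9,10,11,12,13,14,15,16,17,18,19,20,21,22,23}" by (simp, arith)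
  have *: "(r + 24 * m + 1) div 4 = (r + 1) div 4 + 6 * m"
     "((r + 24 * m) div 2 + 1) div 4 = (r div 2 + 1) div 4 + 3 * m"
     "((r + 24 * m) div 3 + 3) div 4 = (r div 3 + 3) div 4 + 2 * m"
     "((r + 24 * m) div 3 + 1) div 4 = (r div 3 + 1) div 4 + 2 * m" by auto
  show ?thesis unfolding t * using r by auto
qed


lemma log_sum_residue_step:
  assumes "a < 4"
  shows "\<exists>n\<in>{Y+1..Y+4}. log_sum_residue a (Y + 4) = log_sum_residue a Y + ln (real n)"
proof -
  \<comment> \<open>As 3 is -1 modulo 4, the offset is the residue of
    \<open>a - (Y + 1)\<close>.\<close>
  define n where "n = Y + 1 + (a + 3 * (Y + 1)) mod 4"
  have n: "n \<in> {Y+1..Y+4}" by (auto simp: n_def)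
  have "n mod 4 = (Y + 1 + (a + 3 * (Y + 1))) mod 4" unfolding n_def by (rule mod_add_right_eq)
  also have "Y + 1 + (a + 3 * (Y + 1)) = a + 4 * (Y + 1)" by simp
  also have "\<dots> mod 4 = a mod 4" by (rule mod_mult_self2)
  finally have nm: "n mod 4 = a" using assms by simp
  have uniq: "n' = n" if "n' \<in> {Y+1..Y+4}" "n' mod 4 = a" for n'
  proof -
    have "n' = 4 * (n' div 4) + a" "n = 4 * (n div 4) + a"
      using mult_div_mod_eq[of 4 n'] mult_div_mod_eq[of 4 n] that nm by simp_all
    moreover from this have "n' div 4 = n div 4" using that n unfolding atLeastAtMost_iff by linarith
    ultimately show ?thesis by metis
  qed
  have "{k. k \<in> {1..Y+4} \<and> k mod 4 = a} = insert n {k. k \<in> {1..Y} \<and> k mod 4 = a}" (is "?A = insert n ?B")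
  proof (intro equalityI subsetI)
    fix k assume "k \<in> ?A"
    thus "k \<in> insert n ?B" using uniq[of k] by (cases "k \<le> Y") auto
  qed (use n nm in auto)
  moreover have "n \<notin> ?B" using n by auto
  ultimately have "log_sum_residue a (Y + 4) = log_sum_residue a Y + ln (real n)"
    unfolding log_sum_residue_def by simp
  with n show ?thesis by blast
qed

definition log_sum :: "nat \<Rightarrow> real" where
  "log_sum Y = (\<Sum>n=1..Y. ln (real n))"

lemma log_sum_Suc: "log_sum (Suc Y) = log_sum Y + ln (real Y + 1)"
  by (simp add: log_sum_def add.commute)

lemma log_sum_residue_nonneg: "log_sum_residue a Y \<ge> 0"
  unfolding log_sum_residue_def by (intro sum_nonneg) auto

lemma log_sum_residue_le: "log_sum_residue a Y \<le> log_sum Y"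
  unfolding log_sum_residue_def log_sum_def by (intro sum_mono2) auto

text \<open>In a block of four numbers above \<open>Z\<close>, four times the selected logarithm
  differs from the sum of all four by at most \<open>4 * ln (Z + 4) - 4 * ln (Z + 1)\<close>, and
  these errors telescope. The 12 pays for \<open>Y < 4\<close>, where
  \<open>log_sum Y \<le> 3\<close>.\<close>

lemma log_sum_residue_approx:
  assumes "a < 4"
  shows "\<bar>4 * log_sum_residue a Y - log_sum Y\<bar> \<le> 4 * ln (real Y + 1) + 12"
proof (induction Y rule: less_induct)
  case (less Y)
  show ?case
  proof (cases "Y < 4")
    case True
    have "log_sum Y \<le> (\<Sum>n=1..3. ln (real n))" unfolding log_sum_def
      using True by (intro sum_mono2) auto
    also have "\<dots> \<le> (\<Sum>n=1..3. real n - 1)" by (intro sum_mono ln_le_minus_one) auto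
    also have "\<dots> = 3" by (simp add: numeral_3_eq_3)
    finally have "log_sum Y \<le> 3" .
    moreover have "ln (real Y + 1) \<ge> 0" by simp
    ultimately show ?thesis
      using log_sum_residue_le[of a Y] log_sum_residue_nonneg[of a Y] unfolding abs_le_iff by linarith
  next
    case False
    define Z where "Z = Y - 4"
    have Y: "Y = Z + 4" and Z: "Z < Y" using False by (auto simp: Z_def)
    obtain n where n: "n \<in> {Z+1..Z+4}" "log_sum_residue a Y = log_sum_residue a Z + ln (real n)"
      using log_sum_residue_step[OF assms, of Z] Y by auto
    have T: "log_sum Y = log_sum Z + ln (real Z + 1) + ln (real Z + 2) + ln (real Z + 3) + ln (real Z + 4)"
      using log_sum_Suc[of Z] log_sum_Suc[of "Suc Z"] log_sum_Suc[of "Suc (Suc Z)"] log_sum_Suc[of "Suc (Suc (Suc Z))"]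
      by (simp add: Y eval_nat_numeral add_ac)
    have m: "ln (real Z + 1) \<le> ln (real n)" "ln (real n) \<le> ln (real Z + 4)"
      "ln (real Z + 1) \<le> ln (real Z + 2)" "ln (real Z + 2) \<le> ln (real Z + 3)" "ln (real Z + 3) \<le> ln (real Z + 4)"
      "ln (real Z + 4) \<le> ln (real Y + 1)"
      using n(1) Y by auto
    define D where "D = ln (real Z + 1) + ln (real Z + 2) + ln (real Z + 3) + ln (real Z + 4)"
    have D: "4 * ln (real Z + 1) \<le> D" "D \<le> 4 * ln (real Z + 4)" using m unfolding D_def by linarith+
    have "4 * log_sum_residue a Y - log_sum Y = (4 * log_sum_residue a Z - log_sum Z) + (4 * ln (real n) - D)"
      unfolding n(2) T D_def by (simp add: algebra_simps)
    moreover have "\<bar>4 * ln (real n) - D\<bar> \<le> 4 * ln (real Z + 4) - 4 * ln (real Z + 1)"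
      using D m(1,2) by linarith
    ultimately show ?thesis using less[OF Z] m(6) by linarith
  qed
qed

text \<open>The main term of Stirling's formula for the logarithm of a factorial.\<close>

definition log_sum_main_term :: "real \<Rightarrow> real" where
  "log_sum_main_term x = x * ln x - x"

lemma mult_ln_Suc_diff_le: "x > 0 \<Longrightarrow> x * (ln (x + 1) - ln x) \<le> (1::real)"
  using ln_le_minus_one[of "(x + 1) / x"] by (simp add: ln_div field_simps)

lemma mult_ln_Suc_diff_ge: "x > 0 \<Longrightarrow> (x + 1) * (ln (x + 1) - ln x) \<ge> (1::real)"
  using ln_le_minus_one[of "x / (x + 1)"] by (simp add: ln_div field_simps)

lemma log_sum_ge: "log_sum_main_term (real Y + 1) - ln (real Y + 1) \<le> log_sum Y"
proof (induction Y)
  case (Suc Y)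
  have "(real Y + 1) * (ln (real Y + 1 + 1) - ln (real Y + 1)) \<le> 1"
    by (rule mult_ln_Suc_diff_le) simp
  with Suc show ?case by (simp add: log_sum_Suc log_sum_main_term_def algebra_simps)
qed (simp add: log_sum_def log_sum_main_term_def)

lemma log_sum_le:
  assumes "Y \<ge> 1"
  shows "log_sum Y \<le> log_sum_main_term (real Y) + 1 + ln (real Y)"
  using assms
proof (induction Y rule: dec_induct)
  case (step Y)
  have "(real Y + 1) * (ln (real Y + 1) - ln (real Y)) \<ge> 1"
    using step by (intro mult_ln_Suc_diff_ge) simp
  with step show ?case by (simp add: log_sum_Suc log_sum_main_term_def algebra_simps)
qed (simp add: log_sum_def log_sum_main_term_def)

lemma log_sum_main_term_mono:
  assumes "1 \<le> x" "x \<le> y"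
  shows "log_sum_main_term x \<le> log_sum_main_term y"
proof -
  have "ln (x / y) \<le> x / y - 1" using assms by (intro ln_le_minus_one) auto
  hence "y * (ln x - ln y) \<le> y * (x / y - 1)" using assms by (intro mult_left_mono) (auto simp: ln_div)
  also have "\<dots> = x - y" using assms by (simp add: field_simps)
  finally have "y * ln y \<ge> y * ln x - x + y" by (simp add: algebra_simps)
  moreover have "y * ln x \<ge> x * ln x" using assms by (intro mult_right_mono) auto
  ultimately show ?thesis by (simp add: log_sum_main_term_def)
qed

text \<open>The real quotient lies between \<open>Y\<close> and \<open>Y + 1\<close> for
  \<open>Y = X div d\<close>. The upper Stirling bound is stated at \<open>Y\<close> and the lower
  one at \<open>Y + 1\<close>, so monotonicity of the main term carries both over to the
  quotient.\<close>

lemma log_sum_div_approx: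
  assumes "1 \<le> d" "d \<le> X"
  shows "\<bar>log_sum (X div d) - log_sum_main_term (real X / real d)\<bar> \<le> ln (real X + 1) + 1"
proof -
  define Y where "Y = X div d"
  have Y1: "Y \<ge> 1" using assms by (simp add: Y_def Suc_le_eq div_greater_zero_iff)
  have YX: "real Y \<le> real X" by (simp add: Y_def)
  have "real_of_int \<lfloor>real X / real d\<rfloor> = real Y" by (simp add: Y_def floor_divide_of_nat_eq)
  hence le: "real Y \<le> real X / real d" and ge: "real X / real d \<le> real Y + 1" by linarith+
  have "log_sum Y \<le> log_sum_main_term (real X / real d) + 1 + ln (real X + 1)"
  proof -
    have "ln (real Y) \<le> ln (real X + 1)" using Y1 YX by (intro ln_mono) auto
    moreover have "log_sum_main_term (real Y) \<le> log_sum_main_term (real X / real d)"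
      using le Y1 by (intro log_sum_main_term_mono) auto
    ultimately show ?thesis using log_sum_le[OF Y1] by linarith
  qed
  moreover have "log_sum Y \<ge> log_sum_main_term (real X / real d) - ln (real X + 1)"
  proof -
    have "ln (real Y + 1) \<le> ln (real X + 1)" using Y1 YX by (intro ln_mono) auto
    moreover have "log_sum_main_term (real X / real d) \<le> log_sum_main_term (real Y + 1)"
      using le ge Y1 by (intro log_sum_main_term_mono) auto
    ultimately show ?thesis using log_sum_ge[of Y] by linarith
  qed
  ultimately show ?thesis by (simp add: Y_def abs_le_iff)
qed

lemma log_sum_residue_div_approx:
  assumes "a < 4" "1 \<le> d" "d \<le> X"
  shows "\<bar>log_sum_residue a (X div d) - log_sum_main_term (real X / real d) / 4\<bar> \<le> 2 * ln (real X + 1) + 4"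
proof -
  have "ln (real (X div d) + 1) \<le> ln (real X + 1)" by (intro ln_mono) auto
  moreover have "ln (real X + 1) \<ge> 0" by simp
  ultimately show ?thesis
    using log_sum_residue_approx[OF assms(1), of "X div d"] log_sum_div_approx[OF assms(2,3)]
    unfolding abs_le_iff by linarith
qed

section \<open>Chebyshev's upper bound for psi\<close>

definition psi :: "nat \<Rightarrow> real" where
  "psi X = (\<Sum>d=1..X. mangoldt d)"

lemma psi_mono: "X \<le> Y \<Longrightarrow> psi X \<le> psi Y"
  unfolding psi_def by (intro sum_mono2) (auto simp: mangoldt_nonneg)

lemma psi_div_eq: "psi (X div k) = (\<Sum>d=1..X. mangoldt d * (if d \<le> X div k then 1 else 0))"
proof -
  have "psi (X div k) = (\<Sum>d\<in>{d\<in>{1..X}. d \<le> X div k}. mangoldt d)"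
    unfolding psi_def by (intro sum.cong) (auto intro: order.trans[OF _ div_le_dividend])
  also have "\<dots> = (\<Sum>d=1..X. if d \<le> X div k then mangoldt d else 0)"
    by (rule sum.inter_filter) simp
  also have "\<dots> = (\<Sum>d=1..X. mangoldt d * (if d \<le> X div k then 1 else 0))"
    by (intro sum.cong) auto
  finally show ?thesis .
qed

lemma le_div_iff_le_div:
  assumes "d \<ge> 1" "k \<ge> (1::nat)"
  shows "d \<le> X div k \<longleftrightarrow> k \<le> X div d"
  using assms by (simp add: less_eq_div_iff_mult_less_eq mult.commute)

lemma div_div_commute: "X div k div d = X div d div (k::nat)"
  by (metis div_mult2_eq mult.commute)

lemma log_sum_eq_sum_mangoldt:
  assumes "Y \<le> X"
  shows "log_sum Y = (\<Sum>d=1..X. mangoldt d * real (Y div d))"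
proof -
  have "log_sum Y = (\<Sum>n | n \<in> {1..Y} \<and> True. ln (real n))"
    unfolding log_sum_def by (intro sum.cong) auto
  also have "\<dots> = (\<Sum>d=1..X. mangoldt d * real (card {k. k \<in> {1..Y div d} \<and> True}))"
    by (rule sum_ln_eq_sum_mangoldt[OF assms])
  also have "\<dots> = (\<Sum>d=1..X. mangoldt d * real (Y div d))"
  proof (rule sum.cong[OF refl])
    fix d
    have "{k. k \<in> {1..Y div d} \<and> True} = {1..Y div d}" by auto
    thus "mangoldt d * real (card {k. k \<in> {1..Y div d} \<and> True}) = mangoldt d * real (Y div d)" by simp
  qed
  finally show ?thesis .
qed

text \<open>With \<open>t = X div d\<close>, the von Mangoldt function enters the right-hand side
  with coefficient \<open>t - 2 * (t div 2)\<close>. This is never negative, and it is 1 for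
  \<open>t = 1\<close>, that is, for \<open>X div 2 < d \<le> X\<close>.\<close>

lemma psi_diff_half_le: "psi X - psi (X div 2) \<le> log_sum X - 2 * log_sum (X div 2)"
proof -
  have "psi X - psi (X div 2) = (\<Sum>d=1..X. mangoldt d * (if 2 \<le> X div d then 0 else 1))"
    unfolding psi_div_eq unfolding psi_def sum_subtractf[symmetric]
    by (intro sum.cong refl) (auto simp: le_div_iff_le_div)
  also have "\<dots> \<le> (\<Sum>d=1..X. mangoldt d * (real (X div d) - 2 * real (X div d div 2)))"
  proof (intro sum_mono mult_left_mono mangoldt_nonneg)
    fix d assume d: "d \<in> {1..X}"
    have "X div d \<ge> 1" using d by (simp add: Suc_le_eq div_greater_zero_iff)
    moreover have "2 * (X div d div 2) \<le> X div d" by simp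
    hence "real (2 * (X div d div 2)) \<le> real (X div d)" by (subst of_nat_le_iff)
    moreover have "X div d div 2 = 0" if "\<not> 2 \<le> X div d" using that by simp
    ultimately show "(if 2 \<le> X div d then 0 else 1) \<le> real (X div d) - 2 * real (X div d div 2)"
      by auto
  qed
  also have "\<dots> = log_sum X - 2 * log_sum (X div 2)"
    by (simp add: log_sum_eq_sum_mangoldt[of _ X] div_div_commute[of X 2] sum_distrib_left
          sum_subtractf[symmetric] algebra_simps)
  finally show ?thesis .
qed

lemma psi_le: "\<exists>C\<ge>0. \<forall>X. psi X \<le> 3 / 2 * real X + C"
proof -
  \<comment> \<open>The 1/20 is what the induction can afford: 25/36 + 1/20 < 3/4, where 25/36
    bounds \<open>ln 2\<close>, and the hypothesis at \<open>X div 2\<close> contributes the other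
    3/4 of the slope 3/2.\<close>
  have "eventually (\<lambda>x::real. 3 * ln (x + 1) + 3 \<le> x / 20) at_top" by real_asymp
  then obtain x0 where x0: "\<And>x::real. x \<ge> x0 \<Longrightarrow> 3 * ln (x + 1) + 3 \<le> x / 20"
    unfolding eventually_at_top_linorder by blast
  define X0 where "X0 = max 2 (nat \<lceil>x0\<rceil>)"
  have *: "psi X \<le> 3 / 2 * real X + psi X0" for X
  proof (induction X rule: less_induct)
    case (less X)
    show ?case
    proof (cases "X \<le> X0")
      case True
      thus ?thesis using psi_mono[OF True] by simp
    next
      case False
      have "2 \<le> X0" "nat \<lceil>x0\<rceil> \<le> X0" unfolding X0_def by (rule max.cobounded1, rule max.cobounded2)
      hence "2 \<le> X" "nat \<lceil>x0\<rceil> \<le> X" using False by linarith+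
      hence X: "X \<ge> 2" "real X \<ge> x0" using real_nat_ceiling_ge[of x0] by linarith+
      have "psi X \<le> psi (X div 2) + (log_sum X - 2 * log_sum (X div 2))"
        using psi_diff_half_le[of X] by simp
      moreover have "psi (X div 2) \<le> 3 / 2 * real (X div 2) + psi X0"
        using X by (intro less) auto
      moreover have "real (X div 2) \<le> real X / 2" by simp
      moreover have "log_sum X \<le> log_sum_main_term (real X) + (ln (real X + 1) + 1)"
        using log_sum_div_approx[of 1 X] X by simp
      moreover have "log_sum (X div 2) \<ge> log_sum_main_term (real X / 2) - (ln (real X + 1) + 1)"
        using log_sum_div_approx[of 2 X] X by simp
      moreover have "log_sum_main_term (real X) - 2 * log_sum_main_term (real X / 2) = real X * ln 2"
        using X by (simp add: log_sum_main_term_def ln_div field_simps)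
      moreover have "real X * ln 2 \<le> real X * (25 / 36)"
        using ln2_le_25_over_36 by (intro mult_left_mono) auto
      moreover have "3 * ln (real X + 1) + 3 \<le> real X / 20" using x0 X by simp
      ultimately show ?thesis by linarith
    qed
  qed
  show ?thesis
    using * by (intro exI[of _ "psi X0"]) (auto simp: psi_def intro!: sum_nonneg mangoldt_nonneg)
qed

section \<open>A dyadic lower bound in the class 1 modulo 4\<close>

definition theta_dyadic :: "nat \<Rightarrow> real" where
  "theta_dyadic X = (\<Sum>d | d \<in> {1..X} \<and> d mod 4 = 1 \<and> X < 2 * d. mangoldt d)"

text \<open>\<open>F\<close> and \<open>G\<close> are the coefficients of \<open>mangoldt d\<close>
  on the left for \<open>d\<close> in class 1 and class 3, as functions of
  \<open>t = X div d\<close>. Both are at most \<open>J\<close>, apart from an extra 1 for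
  \<open>F\<close> at \<open>t = 1\<close>, which singles out the dyadic range. Summing
  \<open>J\<close> gives the two psi terms; for even \<open>d\<close> the coefficient is 0 and
  \<open>J \<ge> 0\<close> is enough.\<close>

lemma theta_dyadic_ge_log_sums:
  "log_sum_residue 1 X - log_sum_residue 1 (X div 2) - log_sum_residue 1 (X div 3) / 2
     - log_sum_residue 3 (X div 3)
   \<le> theta_dyadic X + psi (X div 5) / 2 + psi (X div 17) / 2"
proof -
  define F where "F = (\<lambda>t::nat. real ((t + 3) div 4) - real ((t div 2 + 3) div 4)
    - real ((t div 3 + 3) div 4) / 2 - real ((t div 3 + 1) div 4))"
  define G where "G = (\<lambda>t::nat. real ((t + 1) div 4) - real ((t div 2 + 1) div 4)
    - real ((t div 3 + 1) div 4) / 2 - real ((t div 3 + 3) div 4))"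
  define J where "J = (\<lambda>t::nat. (if 5 \<le> t then 1/2 else 0) + (if 17 \<le> t then 1/2 else (0::real)))"
  have F: "F t \<le> (if t = 1 then 1 else 0) + J t" for t
  proof -
    have "real (2 * ((t + 3) div 4)) \<le> real (2 * ((t div 2 + 3) div 4) + (t div 3 + 3) div 4 + 2 * ((t div 3 + 1) div 4)
     + (if t = 1 then 2 else 0) + (if 5 \<le> t then 1 else 0) + (if 17 \<le> t then 1 else 0))"
      using step_function_1_bound by (subst of_nat_le_iff)
    thus ?thesis unfolding F_def J_def by (simp del: of_nat_div split: if_splits)
  qed
  have G: "G t \<le> J t" for t
  proof -
    have "real (2 * ((t + 1) div 4)) \<le> real (2 * ((t div 2 + 1) div 4) + (t div 3 + 1) div 4 + 2 * ((t div 3 + 3) div 4)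
     + (if 5 \<le> t then 1 else 0))"
      using step_function_3_bound by (subst of_nat_le_iff)
    thus ?thesis unfolding G_def J_def by (simp split: if_splits)
  qed
  have J0: "J t \<ge> 0" for t by (simp add: J_def)
  have "log_sum_residue 1 X - log_sum_residue 1 (X div 2) - log_sum_residue 1 (X div 3) / 2
      - log_sum_residue 3 (X div 3)
    = (\<Sum>d=1..X. mangoldt d * (if d mod 4 = 1 then F (X div d) else if d mod 4 = 3 then G (X div d) else 0))"
    unfolding log_sum_residue_1_eq[of _ X, OF order.refl] log_sum_residue_1_eq[of _ X, OF div_le_dividend]
      log_sum_residue_3_eq[of _ X, OF div_le_dividend] sum_divide_distrib sum_subtractf[symmetric]
      div_div_commute[of X 2] div_div_commute[of X 3]
    by (intro sum.cong refl) (auto simp: F_def G_def algebra_simps)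
  also have "\<dots> \<le> (\<Sum>d=1..X. mangoldt d * ((if d mod 4 = 1 \<and> X div d = 1 then 1 else 0) + J (X div d)))"
  proof (intro sum_mono mult_left_mono mangoldt_nonneg)
    fix d
    show "(if d mod 4 = 1 then F (X div d) else if d mod 4 = 3 then G (X div d) else 0)
      \<le> (if d mod 4 = 1 \<and> X div d = 1 then 1 else 0) + J (X div d)"
      using F[of "X div d"] G[of "X div d"] J0[of "X div d"] by auto
  qed
  also have "\<dots> = (\<Sum>d=1..X. if d mod 4 = 1 \<and> X div d = 1 then mangoldt d else 0)
      + (\<Sum>d=1..X. mangoldt d * J (X div d))"
    by (simp add: sum.distrib[symmetric] algebra_simps) (intro sum.cong, auto)
  also have "(\<Sum>d=1..X. mangoldt d * J (X div d)) = psi (X div 5) / 2 + psi (X div 17) / 2"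
    unfolding psi_div_eq sum_divide_distrib sum.distrib[symmetric] J_def
    by (intro sum.cong refl) (auto simp: le_div_iff_le_div)
  also have "(\<Sum>d=1..X. if d mod 4 = 1 \<and> X div d = 1 then mangoldt d else 0)
      = (\<Sum>d | d \<in> {1..X} \<and> (d mod 4 = 1 \<and> X div d = 1). mangoldt d :: real)"
    by (subst sum.inter_filter[symmetric]) simp_all
  also have "{d. d \<in> {1..X} \<and> (d mod 4 = 1 \<and> X div d = 1)} = {d. d \<in> {1..X} \<and> d mod 4 = 1 \<and> X < 2 * d}"
  proof -
    have "X div d = 1 \<longleftrightarrow> X < 2 * d" if "d \<in> {1..X}" for d
    proof -
      have "X div d \<ge> 1" using that by (simp add: Suc_le_eq div_greater_zero_iff)
      moreover have "X div d < 2 \<longleftrightarrow> X < 2 * d" using that by (simp add: div_less_iff_less_mult)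
      ultimately show ?thesis by linarith
    qed
    thus ?thesis by blast
  qed
  finally show ?thesis by (simp add: theta_dyadic_def)
qed

lemma theta_dyadic_ge: "\<exists>X0. \<forall>X\<ge>X0. theta_dyadic X \<ge> real X / 100"
proof -
  obtain C where C: "C \<ge> 0" "\<And>X. psi X \<le> 3 / 2 * real X + C" using psi_le by blast
  have "eventually (\<lambda>x::real. 4 * (2 * ln (x + 1) + 4) + C \<le> x / 250) at_top" by real_asymp
  then obtain x0 where x0: "\<And>x::real. x \<ge> x0 \<Longrightarrow> 4 * (2 * ln (x + 1) + 4) + C \<le> x / 250"
    unfolding eventually_at_top_linorder by blast
  define X0 where "X0 = max 17 (nat \<lceil>x0\<rceil>)"
  have "theta_dyadic X \<ge> real X / 100" if "X \<ge> X0" for X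
  proof -
    have X: "X \<ge> 17" "real X \<ge> x0" using that by (auto simp: X0_def)
    let ?f = "\<lambda>d. log_sum_main_term (real X / d) / 4" and ?e = "2 * ln (real X + 1) + 4"
    have "log_sum_residue 1 X \<ge> ?f 1 - ?e" "log_sum_residue 1 (X div 2) \<le> ?f 2 + ?e"
      "log_sum_residue 1 (X div 3) \<le> ?f 3 + ?e" "log_sum_residue 3 (X div 3) \<le> ?f 3 + ?e"
      using log_sum_residue_div_approx[of 1 1 X] log_sum_residue_div_approx[of 1 2 X]
        log_sum_residue_div_approx[of 1 3 X] log_sum_residue_div_approx[of 3 3 X] X by (simp_all add: abs_le_iff)
    moreover have "?e \<ge> 0" by simp
    ultimately have "log_sum_residue 1 X - log_sum_residue 1 (X div 2) - log_sum_residue 1 (X div 3) / 2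
        - log_sum_residue 3 (X div 3) \<ge> (?f 1 - ?f 2 - ?f 3 / 2 - ?f 3) - 4 * ?e"
      by argo
    \<comment> \<open>The terms in \<open>X * ln X\<close> cancel because 1 - 1/2 - (3/2)(1/3) = 0;
      only the logarithms of 2 and 3 survive.\<close>
    also have "?f 1 - ?f 2 - ?f 3 / 2 - ?f 3 = real X / 8 * (ln 2 + ln 3)"
      using X by (simp add: log_sum_main_term_def ln_div field_simps)
    finally have *: "real X / 8 * (ln 2 + ln 3) - 4 * ?e \<le> theta_dyadic X + psi (X div 5) / 2 + psi (X div 17) / 2"
      using theta_dyadic_ge_log_sums[of X] by linarith
    \<comment> \<open>Comparing 2^3 with 3^2 gives ln 3 \<ge> (3/2) ln 2 \<ge> 1, hence ln 6 \<ge>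
      5/3.\<close>
    have "3 * ln (2::real) = ln 8" "2 * ln (3::real) = ln 9"
      using ln_realpow[of 2 3] ln_realpow[of 3 2] by simp_all
    moreover have "ln (8::real) \<le> ln 9" by simp
    ultimately have "ln 2 + ln 3 \<ge> (5 / 3 :: real)" using ln2_ge_two_thirds by linarith
    hence **: "real X / 8 * (5 / 3) \<le> real X / 8 * (ln 2 + ln 3)" by (intro mult_left_mono) auto
    have "real (X div 5) \<le> real X / 5" using of_nat_div_le_of_nat[of X 5] by simp
    hence p5: "psi (X div 5) \<le> 3 / 2 * (real X / 5) + C" using C(2)[of "X div 5"] by linarith
    have "real (X div 17) \<le> real X / 17" using of_nat_div_le_of_nat[of X 17] by simp
    hence p17: "psi (X div 17) \<le> 3 / 2 * (real X / 17) + C" using C(2)[of "X div 17"] by linarith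
    have "4 * ?e + C \<le> real X / 250" using x0 X by simp
    \<comment> \<open>Numerically 5/24 - 1/250 - 3/20 - 3/68 exceeds 1/100, with little to
      spare.\<close>
    hence "real X / 8 * (5 / 3) - real X / 250 \<le> theta_dyadic X + 3 / 2 * (real X / 5) / 2 + 3 / 2 * (real X / 17) / 2"
      using * ** p5 p17 by linarith
    thus ?thesis by simp
  qed
  thus ?thesis by blast
qed

lemma card_proper_prime_powers_le:
  assumes "X \<ge> 1"
  shows "real (card {n. n \<in> {1..X} \<and> primepow n \<and> \<not> prime n}) \<le> sqrt (real X) * log 2 (real X)"
proof -
  define s m where "s = nat \<lfloor>sqrt (real X)\<rfloor>" and "m = nat \<lfloor>log 2 (real X)\<rfloor>"
  have "{n. n \<in> {1..X} \<and> primepow n \<and> \<not> prime n} \<subseteq> (\<lambda>(p, k). p ^ k) ` ({1..s} \<times> {1..m})"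
  proof
    fix n assume "n \<in> {n. n \<in> {1..X} \<and> primepow n \<and> \<not> prime n}"
    then obtain p k where pk: "prime p" "k > 0" "n = p ^ k" and n: "n \<le> X" "\<not> prime n"
      by (auto simp: primepow_def)
    have p2: "p \<ge> 2" using pk by (simp add: prime_ge_2_nat)
    have "k \<noteq> 1" using pk n by auto
    hence "2 \<le> k" using pk by linarith
    hence "p ^ 2 \<le> p ^ k" using p2 by (intro power_increasing) auto
    hence "p ^ 2 \<le> X" using n pk by simp
    hence "real p ^ 2 \<le> real X" by (metis of_nat_le_iff of_nat_power)
    hence "real p \<le> sqrt (real X)" by (intro real_le_rsqrt) auto
    hence ps: "p \<le> s" by (simp add: s_def le_nat_floor)
    have "2 ^ k \<le> p ^ k" using p2 by (intro power_mono) auto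
    also have "\<dots> \<le> X" using n pk by simp
    finally have "2 ^ k \<le> X" .
    hence "real (2 ^ k) \<le> real X" by (simp only: of_nat_le_iff)
    hence "2 powr real k \<le> real X" by (simp add: powr_realpow)
    hence "real k \<le> log 2 (real X)" using assms by (simp add: le_log_iff)
    hence "k \<le> m" by (simp add: m_def le_nat_floor)
    hence "(p, k) \<in> {1..s} \<times> {1..m}" using pk ps p2 by simp
    from imageI[OF this, of "\<lambda>(p, k). p ^ k"]
    show "n \<in> (\<lambda>(p, k). p ^ k) ` ({1..s} \<times> {1..m})"
      by (simp only: prod.case pk(3))
  qed
  hence "card {n. n \<in> {1..X} \<and> primepow n \<and> \<not> prime n} \<le> card ((\<lambda>(p, k). p ^ k) ` ({1..s} \<times> {1..m}))"
    by (intro card_mono) auto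
  also have "\<dots> \<le> card ({1..s} \<times> {1..m})" by (rule card_image_le) auto
  finally have "real (card {n. n \<in> {1..X} \<and> primepow n \<and> \<not> prime n}) \<le> real s * real m"
    by (simp flip: of_nat_mult)
  also have "\<dots> \<le> sqrt (real X) * log 2 (real X)"
    using assms by (intro mult_mono) (auto simp: s_def m_def)
  finally show ?thesis .
qed

text \<open>Passes from the von Mangoldt weights to a count of primes: every weight is at most
  \<open>ln X\<close>, and the second term accounts for the proper prime powers.\<close>

lemma theta_dyadic_le:
  assumes "X \<ge> 1"
  shows "theta_dyadic X \<le> (real (card {q. prime q \<and> q mod 4 = 1 \<and> X < 2 * q \<and> q \<le> X})
           + sqrt (real X) * log 2 (real X)) * ln (real X)"
proof -
  let ?P = "{q. prime q \<and> q mod 4 = 1 \<and> X < 2 * q \<and> q \<le> X}"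
  let ?Q = "{n. n \<in> {1..X} \<and> primepow n \<and> \<not> prime n}"
  have fin: "finite ?P" by (rule finite_subset[of _ "{..X}"]) auto
  have finQ: "finite ?Q" by simp
  have "theta_dyadic X = (\<Sum>d | d \<in> {1..X} \<and> d mod 4 = 1 \<and> X < 2 * d \<and> primepow d. mangoldt d)"
    unfolding theta_dyadic_def by (intro sum.mono_neutral_right) (auto simp: mangoldt_def)
  also have "\<dots> \<le> (\<Sum>d\<in>?P \<union> ?Q. mangoldt d)"
    using fin finQ by (intro sum_mono2) (auto simp: mangoldt_nonneg)
  also have "\<dots> \<le> (\<Sum>d\<in>?P \<union> ?Q. ln (real X))"
  proof (intro sum_mono)
    fix d assume "d \<in> ?P \<union> ?Q"
    hence d: "d \<le> X" "primepow d" by auto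
    then obtain p k where pk: "prime p" "k > 0" "d = p ^ k" by (auto simp: primepow_def)
    hence "p \<le> p ^ k" "p \<ge> 1" using prime_gt_0_nat[of p] by (auto intro: self_le_power)
    thus "mangoldt d \<le> ln (real X)" using pk d by (auto intro!: ln_mono)
  qed
  also have "\<dots> = real (card (?P \<union> ?Q)) * ln (real X)" by simp
  also have "\<dots> \<le> (real (card ?P) + real (card ?Q)) * ln (real X)"
    using card_Un_le[of ?P ?Q] assms by (intro mult_right_mono) (simp_all flip: of_nat_add)
  also have "\<dots> \<le> (real (card ?P) + sqrt (real X) * log 2 (real X)) * ln (real X)"
    using card_proper_prime_powers_le[OF assms] assms by (intro mult_right_mono) auto
  finally show ?thesis .
qed

lemma primes_1_mod_4_dyadic:
  "\<exists>X0. \<forall>X\<ge>X0. real (card {q. prime q \<and> q mod 4 = 1 \<and> X < 2 * q \<and> q \<le> X}) \<ge> real X / (200 * ln (real X))"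
proof -
  obtain X1 where X1: "\<And>X. X \<ge> X1 \<Longrightarrow> theta_dyadic X \<ge> real X / 100" using theta_dyadic_ge by blast
  have "eventually (\<lambda>x::real. sqrt x * log 2 x \<le> x / (200 * ln x) \<and> x > 1) at_top"
    by (intro eventually_conj) real_asymp+
  then obtain x0 where x0: "\<And>x::real. x \<ge> x0 \<Longrightarrow> sqrt x * log 2 x \<le> x / (200 * ln x) \<and> x > 1"
    unfolding eventually_at_top_linorder by blast
  have "real (card {q. prime q \<and> q mod 4 = 1 \<and> X < 2 * q \<and> q \<le> X}) \<ge> real X / (200 * ln (real X))"
    if "X \<ge> X1 + nat \<lceil>x0\<rceil>" for X
  proof -
    have "real X \<ge> x0" using that real_nat_ceiling_ge[of x0] by linarith
    note x = x0[OF this]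
    have "real X / 100 \<le> (real (card {q. prime q \<and> q mod 4 = 1 \<and> X < 2 * q \<and> q \<le> X})
           + sqrt (real X) * log 2 (real X)) * ln (real X)"
      using X1[of X] theta_dyadic_le[of X] that x by linarith
    hence "real X / 100 / ln (real X) \<le> real (card {q. prime q \<and> q mod 4 = 1 \<and> X < 2 * q \<and> q \<le> X})
           + sqrt (real X) * log 2 (real X)"
      using x by (subst pos_divide_le_eq) auto
    \<comment> \<open>One half of the lower bound is given up to the prime powers, which explains
      the 200.\<close>
    moreover have "real X / 100 / ln (real X) = real X / (200 * ln (real X)) + real X / (200 * ln (real X))"
      using x by (simp add: field_simps)
    ultimately show ?thesis using x by linarith
  qed
  thus ?thesis by blast
qed

section \<open>Elements near the boundary\<close>

lemma finite_S: "finite (S r N)"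
  by (rule finite_subset[of _ "{..nat \<lceil>N\<rceil>}"]) (auto simp: S_def le_nat_iff, linarith)

lemma S_Prod_prime_factors:
  assumes "n \<in> S r N"
  shows "\<Prod>(prime_factors n) = n"
proof -
  have n: "squarefree n" "n > 0" using assms by (auto simp: S_def intro!: Nat.gr0I)
  have "n = (\<Prod>p\<in>prime_factors n. p ^ multiplicity p n)" by (rule prime_factorization_nat[OF n(2)])
  also have "\<dots> = \<Prod>(prime_factors n)"
    using n(1) squarefree_factorial_semiring'[of n] n(2) by (intro prod.cong) auto
  finally show ?thesis ..
qed

lemma squarefree_Prod_primes:
  assumes "finite A" "\<forall>p\<in>A. prime (p::nat)"
  shows "squarefree (\<Prod>A)"
  using assms by (intro squarefree_prod_coprime) (auto intro: primes_coprime squarefree_prime)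

lemma Prod_in_S:
  assumes "finite A" "\<forall>p\<in>A. prime p \<and> p mod 4 \<noteq> 3" "card A = r" "real (\<Prod>A) < N"
  shows "\<Prod>A \<in> S r N"
  using assms squarefree_Prod_primes[of A] prime_factors_Prod_primes[of A] by (simp add: S_def)

lemma S_pos: "n \<in> S r N \<Longrightarrow> n > 0"
  by (auto simp: S_def intro!: Nat.gr0I)

lemma S_div_prime:
  assumes "n \<in> S r N" "q \<in> prime_factors n"
  shows "n div q = \<Prod>(prime_factors n - {q})" "n = n div q * q" "n div q > 0"
proof -
  have q: "q > 0" using assms by (auto simp: in_prime_factors_iff prime_gt_0_nat)
  have "n = \<Prod>(prime_factors n)" using S_Prod_prime_factors[OF assms(1)] by simp
  also have "\<dots> = q * \<Prod>(prime_factors n - {q})" using assms(2) by (subst prod.remove) auto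
  finally have *: "n = q * \<Prod>(prime_factors n - {q})" .
  show "n div q = \<Prod>(prime_factors n - {q})" by (subst *) (use q in simp)
  with * show "n = n div q * q" by (simp add: mult.commute)
  with S_pos[OF assms(1)] show "n div q > 0" by (metis mult_0 neq0_conv)
qed

text \<open>Both counting arguments below swap one prime in this way. \<open>q'\<close> may equal
  \<open>q\<close>; only the other prime factors have to be avoided.\<close>

lemma exchange_prime:
  assumes "n \<in> S r N" "q \<in> prime_factors n" "prime q'" "q' mod 4 \<noteq> 3" "q' \<notin> prime_factors n - {q}"
    and "real (n div q * q') < N"
  shows "n div q * q' \<in> S r N" "prime_factors (n div q * q') = insert q' (prime_factors n - {q})"
proof -
  let ?A = "insert q' (prime_factors n - {q})"
  have A: "\<Prod>?A = n div q * q'" using assms(5) by (simp add: S_div_prime(1)[OF assms(1,2)] mult.commute)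
  have pr: "\<forall>p\<in>?A. prime p \<and> p mod 4 \<noteq> 3" using assms by (auto simp: S_def)
  have "card ?A = card (prime_factors n)"
    using assms by (metis card.remove card_insert_disjoint finite_Diff finite_set_mset)
  hence "card ?A = r" using assms(1) by (simp add: S_def)
  with Prod_in_S[of ?A r N] A pr assms(6) show "n div q * q' \<in> S r N" by simp
  show "prime_factors (n div q * q') = ?A"
    using prime_factors_Prod_primes[of ?A] pr A by simp
qed

text \<open>All that enters about \<open>B\<close> is its position near \<open>N\<close> and one
  prime factor above \<open>D1\<close> that exceeds twice each of the others. The constant is 13 * 2
  * 200 * 2: 13 from the sieve, 200 from the dyadic lower bound, one factor 2 from
  \<open>ln y \<ge> ln x / 2\<close> and one from \<open>Y \<ge> x / 2\<close>.\<close>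

lemma boundary_count:
  "\<exists>L0\<ge>1. \<forall>N D1 r B. 3 \<le> D1 \<longrightarrow> L0 \<le> ln D1 \<longrightarrow> B \<subseteq> S r N \<longrightarrow>
     (\<forall>n\<in>B. N * (1 - 1 / ln D1) \<le> real n \<and>
        (\<exists>q\<in>prime_factors n. D1 < real q \<and> (\<forall>p\<in>prime_factors n - {q}. 2 * p < q))) \<longrightarrow>
     real (card B) \<le> 10400 / ln D1 * real (Phi r N)"
proof -
  obtain y0 where y0: "\<And>u y. u \<ge> 0 \<Longrightarrow> y \<ge> y0 \<Longrightarrow>
      real (card {q. prime q \<and> u \<le> real q \<and> real q < u + y}) \<le> 13 * y / ln y"
    using brun_titchmarsh by blast
  obtain X0 where X0: "\<And>X. X \<ge> X0 \<Longrightarrow>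
      real (card {q. prime q \<and> q mod 4 = 1 \<and> X < 2 * q \<and> q \<le> X}) \<ge> real X / (200 * ln (real X))"
    using primes_1_mod_4_dyadic by blast
  \<comment> \<open>For such \<open>x\<close> an interval of length \<open>x / ln x\<close> is long
    enough for the sieve, its logarithm is at least half of \<open>ln x\<close>, and the integer
    just below \<open>x\<close> is large enough for the dyadic bound.\<close>
  have "eventually (\<lambda>x::real. x / ln x \<ge> max y0 2 \<and> ln (x / ln x) \<ge> ln x / 2 \<and> x \<ge> 4 + real X0) at_top"
    by (intro eventually_conj) real_asymp+
  then obtain x0 where x0: "\<And>x::real. x \<ge> x0 \<Longrightarrow>
      x / ln x \<ge> max y0 2 \<and> ln (x / ln x) \<ge> ln x / 2 \<and> x \<ge> 4 + real X0"
    unfolding eventually_at_top_linorder by blast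
  show ?thesis
  proof (intro exI[of _ "max 1 (ln (max x0 1))"] conjI allI impI)
    fix N D1 :: real and r :: nat and B :: "nat set"
    assume D1: "3 \<le> D1" and L0: "max 1 (ln (max x0 1)) \<le> ln D1" and B: "B \<subseteq> S r N"
      and P: "\<forall>n\<in>B. N * (1 - 1 / ln D1) \<le> real n \<and>
        (\<exists>q\<in>prime_factors n. D1 < real q \<and> (\<forall>p\<in>prime_factors n - {q}. 2 * p < q))"
    define L where "L = ln D1"
    have L: "L \<ge> 1" using L0 by (simp add: L_def)
    have D1x0: "D1 \<ge> x0" using L0 D1 by simp
    have finB: "finite B" using B finite_S finite_subset by blast
    from P have "\<forall>n\<in>B. \<exists>q. q \<in> prime_factors n \<and> D1 < real q \<and> (\<forall>p\<in>prime_factors n - {q}. 2 * p < q)" by blast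
    then obtain f where f: "\<And>n. n \<in> B \<Longrightarrow> f n \<in> prime_factors n" "\<And>n. n \<in> B \<Longrightarrow> D1 < real (f n)"
      "\<And>n p. n \<in> B \<Longrightarrow> p \<in> prime_factors n - {f n} \<Longrightarrow> 2 * p < f n"
      by (auto dest!: bchoice)
    define g where "g = (\<lambda>n. n div f n)"
    \<comment> \<open>The largest integer strictly below \<open>N / m\<close>; elements of
      \<open>S r N\<close> are strictly smaller than \<open>N\<close>.\<close>
    define X where "X = (\<lambda>m::nat. nat (\<lceil>N / real m\<rceil> - 1))"
    define G where "G = (\<lambda>m. {q. prime q \<and> q mod 4 = 1 \<and> X m < 2 * q \<and> q \<le> X m})"
    have finG: "finite (G m)" for m by (rule finite_subset[of _ "{..X m}"]) (auto simp: G_def)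
    have n_eq: "n = g n * f n" "g n > 0" if "n \<in> B" for n
      using S_div_prime(2,3)[of n r N "f n"] that B f(1) by (auto simp: g_def)
    have X_less: "real (X (g n)) < N / real (g n)" and X_ge: "f n \<le> X (g n)"
      and X_Suc: "N / real (g n) \<le> real (X (g n)) + 1" if "n \<in> B" for n
    proof -
      have "real (g n) * real (f n) < N" using n_eq[OF that] that B by (auto simp: S_def simp flip: of_nat_mult)
      hence "real (f n) < N / real (g n)" using n_eq(2)[OF that] by (simp add: less_divide_eq mult.commute)
      hence *: "int (f n) \<le> \<lceil>N / real (g n)\<rceil> - 1" by (simp add: less_ceiling_iff zle_diff1_eq)
      thus "f n \<le> X (g n)" unfolding X_def by linarith
      have "real (X (g n)) = real_of_int (\<lceil>N / real (g n)\<rceil> - 1)" using * unfolding X_def by simp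
      thus "real (X (g n)) < N / real (g n)" "N / real (g n) \<le> real (X (g n)) + 1" by linarith+
    qed
    have new: "g n * q \<in> S r N" "prime_factors (g n * q) = insert q (prime_factors n - {f n})"
       "\<forall>p\<in>prime_factors n - {f n}. p < q"
      if n: "n \<in> B" and q: "q \<in> G (g n)" for n q
    proof -
      \<comment> \<open>The chain is \<open>2 * p < f n \<le> X (g n) < 2 * q\<close>: the factor 2
        in the spacing compensates for \<open>q\<close> ranging down to half of
        \<open>X (g n)\<close>.\<close>
      show less: "\<forall>p\<in>prime_factors n - {f n}. p < q"
      proof
        fix p assume "p \<in> prime_factors n - {f n}"
        hence "2 * p < f n" by (rule f(3)[OF n])
        moreover have "X (g n) < 2 * q" using q by (simp add: G_def)
        ultimately show "p < q" using X_ge[OF n] by linarith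
      qed
      have "real (g n) * real q \<le> real (g n) * real (X (g n))" using q by (intro mult_left_mono) (auto simp: G_def)
      also have "\<dots> < N" using X_less[OF n] n_eq(2)[OF n] by (simp add: less_divide_eq mult.commute)
      finally have *: "real (n div f n * q) < N" by (simp add: g_def)
      show "g n * q \<in> S r N" "prime_factors (g n * q) = insert q (prime_factors n - {f n})"
      proof -
        have "n \<in> S r N" using n B by auto
        moreover have "prime q" "q mod 4 \<noteq> 3" using q by (auto simp: G_def)
        moreover have "q \<notin> prime_factors n - {f n}" using less by blast
        ultimately show "g n * q \<in> S r N" "prime_factors (g n * q) = insert q (prime_factors n - {f n})"
          unfolding g_def using exchange_prime[OF _ f(1)[OF n] _ _ _ *] by blast+
      qed
    qed
    have Max: "Max (prime_factors (g n * q)) = q" if "n \<in> B" "q \<in> G (g n)" for n q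
      unfolding new(2)[OF that] using new(3)[OF that] by (intro Max_eqI) (auto intro: less_imp_le)
    \<comment> \<open>\<open>q\<close> is recovered as the largest prime factor of the product, and
      then \<open>m\<close> by division.\<close>
    have "card (Sigma (g ` B) G) \<le> card (S r N)"
    proof (rule card_inj_on_le[where f = "\<lambda>(m, q). m * q"])
      show "inj_on (\<lambda>(m, q). m * q) (Sigma (g ` B) G)"
      proof (rule inj_onI, clarify)
        fix n q n' q' assume *: "n \<in> B" "q \<in> G (g n)" "n' \<in> B" "q' \<in> G (g n')" "g n * q = g n' * q'"
        have "q = q'" using Max[OF *(1,2)] Max[OF *(3,4)] *(5) by simp
        moreover have "q > 0" using *(2) by (auto simp: G_def prime_gt_0_nat)
        ultimately show "g n = g n' \<and> q = q'" using *(5) by simp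
      qed
    qed (use new(1) finite_S in auto)
    hence SigmaG: "(\<Sum>m\<in>g ` B. real (card (G m))) \<le> real (Phi r N)"
      using finB finG by (simp add: Phi_def card_SigmaI flip: of_nat_sum)
    have fibre: "real (card {n \<in> B. g n = m}) \<le> 10400 / L * real (card (G m))" if mB: "m \<in> g ` B" for m
    proof -
      obtain n where n: "n \<in> B" "m = g n" using mB by auto
      define x where "x = N / real m"
      define y where "y = x / L"
      have m: "m > 0" using n n_eq by simp
      have x: "x > D1" using f(2)[OF n(1)] X_ge[OF n(1)] X_less[OF n(1)] n(2) by (simp add: x_def)
      hence xx: "x \<ge> x0" "x > 3" using D1x0 D1 by auto
      note x0' = x0[OF xx(1)]
      have lnx: "ln x \<ge> L" "ln x \<ge> 1" using x D1 L unfolding L_def by (auto intro!: ln_mono order.trans[OF L[unfolded L_def]])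
      have y: "y \<ge> x / ln x" unfolding y_def using lnx L xx by (intro divide_left_mono) auto
      have "ln y \<ge> ln (x / ln x)" using y xx lnx by (intro ln_mono) auto
      hence lny: "ln y \<ge> ln x / 2" using x0' by linarith
      \<comment> \<open>On a fibre, \<open>n\<close> is determined by the prime \<open>f n\<close>,
        which closeness to \<open>N\<close> confines to an interval of length \<open>x / L\<close>
        ending at \<open>x\<close>.\<close>
      have "card {n \<in> B. g n = m} \<le> card {q. prime q \<and> x * (1 - 1 / L) \<le> real q \<and> real q < x * (1 - 1 / L) + y}"
      proof (rule card_inj_on_le[where f = f])
        show "inj_on f {n \<in> B. g n = m}" by (rule inj_onI) (use n_eq in \<open>metis (mono_tags, lifting) mem_Collect_eq\<close>)
        show "f ` {n \<in> B. g n = m} \<subseteq> {q. prime q \<and> x * (1 - 1 / L) \<le> real q \<and> real q < x * (1 - 1 / L) + y}"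
        proof (clarify, intro conjI)
          fix n' assume n': "n' \<in> B" "m = g n'"
          show "prime (f n')" using f(1)[OF n'(1)] by auto
          have "N * (1 - 1 / L) \<le> real m * real (f n')"
            using P n' n_eq(1)[OF n'(1)] by (simp add: L_def flip: of_nat_mult)
          thus "x * (1 - 1 / L) \<le> real (f n')" using m n' by (simp add: x_def divide_le_eq mult.commute)
          have "real (f n') < x" using X_ge[OF n'(1)] X_less[OF n'(1)] n' by (simp add: x_def)
          thus "real (f n') < x * (1 - 1 / L) + y" by (simp add: y_def algebra_simps)
        qed
        show "finite {q. prime q \<and> x * (1 - 1 / L) \<le> real q \<and> real q < x * (1 - 1 / L) + y}"
          by (rule finite_subset[of _ "{..nat \<lceil>x * (1 - 1 / L) + y\<rceil>}"]) (auto simp: le_nat_iff, linarith)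
      qed
      hence "real (card {n \<in> B. g n = m})
          \<le> real (card {q. prime q \<and> x * (1 - 1 / L) \<le> real q \<and> real q < x * (1 - 1 / L) + y})" by simp
      also have "\<dots> \<le> 13 * y / ln y"
        using y0[of "x * (1 - 1 / L)" y] y x0' xx L by (simp add: max_def split: if_splits)
      also have "\<dots> \<le> 13 * y / (ln x / 2)"
      proof (intro divide_left_mono mult_pos_pos)
        show "0 \<le> 13 * y" using xx L by (simp add: y_def)
      qed (use lny lnx in linarith)+
      also have "\<dots> = 26 / L * (x / ln x)" using lnx L by (simp add: y_def field_simps)
      also have "\<dots> \<le> 26 / L * (400 * real (card (G m)))"
      proof (rule mult_left_mono)
        define Y where "Y = X m"
        have Y: "real Y < x" "x \<le> real Y + 1" using X_less[OF n(1)] X_Suc[OF n(1)] n(2) by (auto simp: Y_def x_def)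
        hence Y2: "Y \<ge> X0" "real Y \<ge> x / 2" "real Y > 1" using x0' by auto
        have "x / ln x = 400 * ((x / 2) / (200 * ln x))" by simp
        also have "(x / 2) / (200 * ln x) \<le> real Y / (200 * ln (real Y))"
          using Y Y2 xx lnx by (intro frac_le) auto
        also have "\<dots> \<le> real (card (G m))" using X0[OF Y2(1)] by (simp add: G_def Y_def)
        finally show "x / ln x \<le> 400 * real (card (G m))" by simp
      qed (use L in simp)
      finally show ?thesis by simp
    qed
    have "real (card B) = (\<Sum>n\<in>B. 1)" by simp
    also have "\<dots> = (\<Sum>m\<in>g ` B. \<Sum>n\<in>{n\<in>B. g n = m}. 1)" by (rule sum.image_gen[OF finB])
    also have "\<dots> \<le> (\<Sum>m\<in>g ` B. 10400 / L * real (card (G m)))"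
      using fibre by (intro sum_mono) simp
    also have "\<dots> = 10400 / L * (\<Sum>m\<in>g ` B. real (card (G m)))" by (simp add: sum_distrib_left)
    also have "\<dots> \<le> 10400 / L * real (Phi r N)" using SigmaG L by (intro mult_left_mono) auto
    finally show "real (card B) \<le> 10400 / ln D1 * real (Phi r N)" by (simp add: L_def)
  qed simp
qed

text \<open>Double counting: in an \<open>n\<close> divisible by \<open>d\<close>, the prime
  \<open>d\<close> is replaced by primes \<open>q \<le> d\<close> in class 1 with
  \<open>d < 2 * q\<close>, which keeps the product below \<open>N\<close>. Every \<open>n\<close>
  has at least \<open>ln d\<close> admissible \<open>q\<close>, whereas an image has only
  \<open>r\<close> prime factors that could have been inserted. \<open>L0\<close> depends on
  \<open>r\<close> because up to \<open>r\<close> of the \<open>q\<close> may already divide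
  \<open>n\<close>.\<close>

lemma multiples_of_prime_count:
  "\<exists>L0. \<forall>N d. prime d \<longrightarrow> d mod 4 = 1 \<longrightarrow> L0 \<le> ln (real d) \<longrightarrow>
     real (card {n \<in> S r N. d \<in> prime_factors n}) \<le> real r / ln (real d) * real (Phi r N)"
proof -
  obtain X0 where X0: "\<And>X. X \<ge> X0 \<Longrightarrow>
      real (card {q. prime q \<and> q mod 4 = 1 \<and> X < 2 * q \<and> q \<le> X}) \<ge> real X / (200 * ln (real X))"
    using primes_1_mod_4_dyadic by blast
  have "eventually (\<lambda>x::real. x / (200 * ln x) \<ge> real r + ln x \<and> x > real X0 + 1) at_top"
    by (intro eventually_conj) real_asymp+
  then obtain x0 where x0: "\<And>x::real. x \<ge> x0 \<Longrightarrow> x / (200 * ln x) \<ge> real r + ln x \<and> x > real X0 + 1"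
    unfolding eventually_at_top_linorder by blast
  have "real (card {n \<in> S r N. d \<in> prime_factors n}) \<le> real r / ln (real d) * real (Phi r N)"
    if d: "prime d" "d mod 4 = 1" and L0: "ln (max x0 1) \<le> ln (real d)" for N d
  proof -
    let ?B = "{n \<in> S r N. d \<in> prime_factors n}"
    define Q where "Q = {q. prime q \<and> q mod 4 = 1 \<and> d < 2 * q \<and> q \<le> d}"
    define E where "E = (SIGMA n:?B. {q \<in> Q. q \<notin> prime_factors n - {d}})"
    have d1: "real d > 1" using d prime_gt_1_nat by simp
    have finQ: "finite Q" by (rule finite_subset[of _ "{..d}"]) (auto simp: Q_def)
    have finB: "finite ?B" using finite_S by simp
    have dx: "real d \<ge> x0" using L0 d1 by simp
    have Qge: "real (card Q) \<ge> real r + ln (real d)"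
      using X0[of d] x0[OF dx] by (simp add: Q_def)
    have Ege: "real (card ?B) * ln (real d) \<le> real (card E)"
    proof -
      have "ln (real d) \<le> real (card {q \<in> Q. q \<notin> prime_factors n - {d}})" if n: "n \<in> ?B" for n
      proof -
        have "Q \<subseteq> {q \<in> Q. q \<notin> prime_factors n - {d}} \<union> prime_factors n" by auto
        hence "card Q \<le> card ({q \<in> Q. q \<notin> prime_factors n - {d}} \<union> prime_factors n)"
          using finQ by (intro card_mono) auto
        also have "\<dots> \<le> card {q \<in> Q. q \<notin> prime_factors n - {d}} + card (prime_factors n)" by (rule card_Un_le)
        also have "card (prime_factors n) = r" using n by (simp add: S_def)
        finally show ?thesis using Qge by linarith
      qed
      hence "(\<Sum>n\<in>?B. ln (real d)) \<le> (\<Sum>n\<in>?B. real (card {q \<in> Q. q \<notin> prime_factors n - {d}}))"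
        by (intro sum_mono) auto
      thus ?thesis using finB finQ by (simp add: E_def card_SigmaI)
    qed
    have "card E \<le> card (SIGMA n:S r N. prime_factors n)"
    \<comment> \<open>The second component records which prime was inserted; the product alone would
      not determine \<open>n\<close>.\<close>
    proof (rule card_inj_on_le[where f = "\<lambda>(n, q). (n div d * q, q)"])
      show "inj_on (\<lambda>(n, q). (n div d * q, q)) E"
      proof (rule inj_onI)
        fix z z' assume zE: "z \<in> E" "z' \<in> E" "(\<lambda>(n, q). (n div d * q, q)) z = (\<lambda>(n, q). (n div d * q, q)) z'"
        obtain n q n' q' where z: "z = (n, q)" "z' = (n', q')" by (metis surj_pair)
        have qq: "q' = q" using zE unfolding z by simp
        have *: "(n, q) \<in> E" "(n', q) \<in> E" "n div d * q = n' div d * q"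
          using zE unfolding z qq by simp_all
        have "q > 0" using *(1) by (auto simp: E_def Q_def prime_gt_0_nat)
        hence "n div d = n' div d" using *(3) by simp
        moreover have "n = n div d * d" "n' = n' div d * d"
          using *(1,2) S_div_prime(2) by (auto simp: E_def)
        ultimately show "z = z'" unfolding z qq by metis
      qed
      show "(\<lambda>(n, q). (n div d * q, q)) ` E \<subseteq> (SIGMA n:S r N. prime_factors n)"
      proof
        fix z assume "z \<in> (\<lambda>(n, q). (n div d * q, q)) ` E"
        then obtain n q where nq: "(n, q) \<in> E" and z: "z = (n div d * q, q)" by auto
        from nq have n: "n \<in> S r N" "d \<in> prime_factors n" and q: "prime q" "q mod 4 = 1" "q \<le> d" "q \<notin> prime_factors n - {d}"
          by (auto simp: E_def Q_def)
        have "n div d * q \<le> n div d * d" using q by simp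
        also have "\<dots> = n" using S_div_prime(2)[OF n] by simp
        finally have "real (n div d * q) \<le> real n" by (simp only: of_nat_le_iff)
        also have "\<dots> < N" using n by (simp add: S_def)
        finally have less: "real (n div d * q) < N" .
        have "q mod 4 \<noteq> 3" using q by simp
        from exchange_prime[OF n q(1) this q(4) less]
        show "z \<in> (SIGMA n:S r N. prime_factors n)" unfolding z by auto
      qed
    qed (use finite_S in auto)
    also have "\<dots> = (\<Sum>n\<in>S r N. card (prime_factors n))" using finite_S by (simp add: card_SigmaI)
    also have "\<dots> = (\<Sum>n\<in>S r N. r)" by (intro sum.cong) (auto simp: S_def)
    also have "\<dots> = r * Phi r N" by (simp add: Phi_def mult.commute)
    finally have "real (card E) \<le> real r * real (Phi r N)" by (simp flip: of_nat_mult)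
    with Ege have "real (card ?B) * ln (real d) \<le> real r * real (Phi r N)" by linarith
    thus ?thesis using d1 by (simp add: field_simps)
  qed
  thus ?thesis by blast
qed

section \<open>A grid of boxes\<close>

definition nth_prime_factor :: "nat \<Rightarrow> nat \<Rightarrow> nat" where
  "nth_prime_factor n i = sorted_list_of_set (prime_factors n) ! (i - 1)"

text \<open>Identifies the coordinates of a box element with its sorted prime factors, since a
  finite set has only one increasing enumeration.\<close>

lemma nth_prime_factor_eq:
  assumes "strict_mono_on {1..r} x" "prime_factors n = x ` {1..r}" "i \<in> {1..r}"
  shows "nth_prime_factor n i = x i"
proof -
  let ?xs = "map x [1..<Suc r]"
  have nth: "?xs ! j = x (Suc j)" if "j < r" for j using that by (simp del: upt_Suc)
  have "sorted_wrt (<) ?xs"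
    unfolding sorted_wrt_iff_nth_less
  proof (intro allI impI)
    fix j l assume jl: "j < l" "l < length ?xs"
    hence "l < r" by (simp del: upt_Suc)
    with jl have "x (Suc j) < x (Suc l)" by (intro strict_mono_onD[OF assms(1)]) auto
    thus "?xs ! j < ?xs ! l" using jl \<open>l < r\<close> nth[of j] nth[of l] by linarith
  qed
  moreover have "set ?xs = prime_factors n" using assms(2) by auto
  ultimately have "sorted_list_of_set (prime_factors n) = ?xs"
    by (metis sorted_list_of_set.idem_if_sorted_distinct strict_sorted_iff)
  moreover obtain j where "i = Suc j" "j < r" using assms(3) by (cases i) auto
  ultimately show ?thesis using nth[of j] by (simp only: nth_prime_factor_def diff_Suc_1)
qed

lemma strict_mono_on_nth_prime_factor:
  "strict_mono_on {1..card (prime_factors n)} (nth_prime_factor n)"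
proof (rule strict_mono_onI)
  fix i j assume "i \<in> {1..card (prime_factors n)}" "j \<in> {1..card (prime_factors n)}" "i < j"
  thus "nth_prime_factor n i < nth_prime_factor n j"
    using sorted_wrt_nth_less[OF strict_sorted_list_of_set, of "i - 1" "j - 1" "prime_factors n"]
    by (simp add: nth_prime_factor_def diff_less_mono)
qed

lemma image_nth_prime_factor: "nth_prime_factor n ` {1..card (prime_factors n)} = prime_factors n"
proof -
  let ?xs = "sorted_list_of_set (prime_factors n)"
  have "nth_prime_factor n ` {1..card (prime_factors n)} = (!) ?xs ` {0..<card (prime_factors n)}" (is "?l = ?r")
  proof (intro equalityI subsetI)
    fix p assume "p \<in> ?l"
    then obtain i where i: "i \<in> {1..card (prime_factors n)}" "p = ?xs ! (i - 1)"
      by (auto simp: nth_prime_factor_def)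
    thus "p \<in> ?r" by (intro image_eqI[of _ _ "i - 1"]) auto
  next
    fix p assume "p \<in> ?r"
    then obtain i where i: "i < card (prime_factors n)" "p = ?xs ! i" by auto
    thus "p \<in> ?l" by (intro image_eqI[of _ _ "Suc i"]) (auto simp: nth_prime_factor_def)
  qed
  also have "\<dots> = prime_factors n"
    using nth_image[of "card (prime_factors n)" ?xs] by simp
  finally show ?thesis .
qed

lemma comfortably_spaced_nth:
  assumes "comfortably_spaced D1 n" "i \<in> {1..card (prime_factors n)}" "D1 < real (nth_prime_factor n i)"
  shows "2 * D1 < real (nth_prime_factor n i)"
    and "i < card (prime_factors n) \<Longrightarrow> 2 * real (nth_prime_factor n i) < real (nth_prime_factor n (Suc i))"
proof -
  obtain j where j: "i = Suc j" "j < card (prime_factors n)" using assms(2) by (cases i) auto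
  define ps where "ps = sorted_list_of_set (prime_factors n)"
  have ps: "length ps = card (prime_factors n)" "\<And>i. nth_prime_factor n (Suc i) = ps ! i"
    by (simp_all add: ps_def nth_prime_factor_def)
  have "2 * D1 < real (ps ! j) \<and> (Suc j < card (prime_factors n) \<longrightarrow> real (ps ! j) < real (ps ! Suc j) / 2)"
    using assms(1,3) j unfolding comfortably_spaced_def Let_def ps_def[symmetric] by (simp add: ps)
  thus "2 * D1 < real (nth_prime_factor n i)"
    and "i < card (prime_factors n) \<Longrightarrow> 2 * real (nth_prime_factor n i) < real (nth_prime_factor n (Suc i))"
    unfolding j(1) ps(2) by auto
qed

definition small_count :: "real \<Rightarrow> nat \<Rightarrow> nat" where
  "small_count D1 n = card {p \<in> prime_factors n. real p < D1}"

text \<open>The indices with \<open>x i < D\<close> form an initial segment, so its length decides.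
  For \<open>D = D1\<close> this length is the parameter \<open>k\<close> of a box.\<close>

lemma strict_mono_on_less_iff_le_card:
  fixes x :: "nat \<Rightarrow> nat" and D :: real
  assumes x: "strict_mono_on {1..r} x" and i: "i \<in> {1..r}"
  shows "real (x i) < D \<longleftrightarrow> i \<le> card {p \<in> x ` {1..r}. real p < D}"
proof -
  define I where "I = {j \<in> {1..r}. real (x j) < D}"
  have inj: "inj_on x {1..r}" using x by (rule strict_mono_on_imp_inj_on)
  have "{p \<in> x ` {1..r}. real p < D} = x ` I" by (auto simp: I_def)
  moreover have "inj_on x I" using inj by (rule inj_on_subset) (auto simp: I_def)
  ultimately have c: "card {p \<in> x ` {1..r}. real p < D} = card I" by (simp add: card_image)
  have finI: "finite I" by (simp add: I_def)
  show ?thesis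
  proof
    assume *: "real (x i) < D"
    have "{1..i} \<subseteq> I"
    proof
      fix j assume j: "j \<in> {1..i}"
      hence "x j \<le> x i" using i x strict_mono_onD[OF x, of j i] by (cases "j = i") auto
      thus "j \<in> I" using j i * by (auto simp: I_def)
    qed
    from card_mono[OF finI this] show "i \<le> card {p \<in> x ` {1..r}. real p < D}" using c by simp
  next
    assume *: "i \<le> card {p \<in> x ` {1..r}. real p < D}"
    show "real (x i) < D"
    proof (rule ccontr)
      assume n: "\<not> real (x i) < D"
      have "I \<subseteq> {1..<i}"
      proof
        fix j assume j: "j \<in> I"
        have "\<not> i \<le> j"
        proof
          assume "i \<le> j"
          hence "x i \<le> x j" using i j strict_mono_onD[OF x, of i j] by (cases "j = i") (auto simp: I_def)
          thus False using n j by (auto simp: I_def)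
        qed
        thus "j \<in> {1..<i}" using j by (auto simp: I_def)
      qed
      hence "card I \<le> i - 1" using card_mono[of "{1..<i}" I] by simp
      thus False using * c i by auto
    qed
  qed
qed

section \<open>Cells of a geometric grid\<close>

definition eta :: "real \<Rightarrow> real \<Rightarrow> real" where
  "eta D1 u = 1 / (exp u * ln D1)"

text \<open>The left end of the cell containing \<open>q\<close> in the grid of all points
  \<open>b * (1 + e) powr c\<close> with \<open>c\<close> an integer.\<close>

definition cell_lower :: "real \<Rightarrow> real \<Rightarrow> real \<Rightarrow> real" where
  "cell_lower b e q = b * (1 + e) powr real_of_int \<lfloor>log (1 + e) (q / b)\<rfloor>"

lemma cell_lower_bounds:
  assumes "e > 0" "b > 0" "q > 0"
  shows "cell_lower b e q \<le> q" "q < (1 + e) * cell_lower b e q" "cell_lower b e q > 0"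
proof -
  let ?l = "log (1 + e) (q / b)"
  have q: "q = b * (1 + e) powr ?l" using assms by (subst powr_log_cancel) auto
  show "cell_lower b e q > 0" using assms by (simp add: cell_lower_def)
  have "(1 + e) powr real_of_int \<lfloor>?l\<rfloor> \<le> (1 + e) powr ?l" using assms by (intro powr_mono) auto
  hence "cell_lower b e q \<le> b * (1 + e) powr ?l"
    unfolding cell_lower_def using assms by (intro mult_left_mono) auto
  thus "cell_lower b e q \<le> q" using q by linarith
  have "b * (1 + e) powr ?l < b * (1 + e) powr (1 + real_of_int \<lfloor>?l\<rfloor>)"
    using assms by (intro mult_strict_left_mono powr_less_mono) linarith+
  also have "\<dots> = (1 + e) * cell_lower b e q" using assms by (simp add: powr_add cell_lower_def)
  finally show "q < (1 + e) * cell_lower b e q" using q by linarith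
qed

lemma cell_lower_cong:
  assumes "e > 0" "b > 0" "cell_lower b e q < y" "y < (1 + e) * cell_lower b e q"
  shows "cell_lower b e y = cell_lower b e q"
proof -
  define c where "c = \<lfloor>log (1 + e) (q / b)\<rfloor>"
  have s: "cell_lower b e q = b * (1 + e) powr real_of_int c" by (simp add: cell_lower_def c_def)
  have "y > 0" using assms(1,2,3) by (simp add: s) (smt (verit) powr_ge_zero zero_le_mult_iff)
  have "(1 + e) powr real_of_int c < y / b" using assms(2,3) by (simp add: s field_simps)
  hence "real_of_int c < log (1 + e) (y / b)" using assms \<open>y > 0\<close> by (subst less_log_iff) auto
  moreover have "y / b < (1 + e) powr (real_of_int c + 1)"
    using assms(1,2,4) by (simp add: s powr_add field_simps)
  hence "log (1 + e) (y / b) < real_of_int c + 1" using assms \<open>y > 0\<close> by (subst log_less_iff) auto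
  ultimately have "\<lfloor>log (1 + e) (y / b)\<rfloor> = c" by linarith
  thus ?thesis unfolding s by (simp add: cell_lower_def)
qed

lemma eta_pos: "D1 > 1 \<Longrightarrow> eta D1 u > 0"
  by (simp add: eta_def)

text \<open>Box components are open intervals, so a prime on a grid point would lie in no cell. A
  bad \<open>b\<close> has the form \<open>q / (1 + eta D1 j) powr c\<close> with natural
  \<open>q\<close>, \<open>j\<close> and an integer \<open>c\<close>; these are countably
  many.\<close>

lemma generic_base:
  assumes "D1 > 1"
  shows "\<exists>b\<in>{1<..<2::real}. \<forall>(q::nat) (j::nat). real q \<noteq> cell_lower b (eta D1 (real j)) (real q)"
proof -
  define h where "h = (\<lambda>(q::nat, j::nat, c::int). real q / (1 + eta D1 (real j)) powr real_of_int c)"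
  have "countable (range h)" by simp
  moreover have "uncountable {1<..<2::real}" by (simp add: uncountable_open_interval)
  ultimately have "\<not> {1<..<2::real} \<subseteq> range h" using countable_subset by blast
  then obtain b where b: "b \<in> {1<..<2}" "b \<notin> range h" by blast
  have "real q \<noteq> cell_lower b (eta D1 (real j)) (real q)" for q j
  proof
    let ?e = "eta D1 (real j)"
    define c where "c = \<lfloor>log (1 + ?e) (real q / b)\<rfloor>"
    assume "real q = cell_lower b ?e (real q)"
    hence "real q = b * (1 + ?e) powr real_of_int c" unfolding cell_lower_def c_def .
    moreover have "(1 + ?e) powr real_of_int c > 0" using eta_pos[OF assms, of "real j"] by simp
    ultimately have "b = h (q, j, c)" by (simp add: h_def)
    thus False using b by blast
  qed
  thus ?thesis using b by blast
qed

text \<open>The bound 10 makes all cells above \<open>D1\<close> narrow compared with the factor-2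
  spacing. \<open>generic\<close> ranges over natural \<open>j\<close> because the width at an index
  \<open>i > k\<close> depends only on \<open>i - k\<close>.\<close>

locale prime_grid =
  fixes D1 b :: real
  assumes D1: "3 \<le> D1" and ln_D1: "10 \<le> ln D1" and b: "1 < b"
    and generic: "\<And>(q::nat) (j::nat). real q \<noteq> cell_lower b (eta D1 (real j)) (real q)"
begin

definition width :: "nat \<Rightarrow> nat \<Rightarrow> real" where
  "width n i = eta D1 (real i - real (small_count D1 n))"

definition lower :: "nat \<Rightarrow> nat \<Rightarrow> real" where
  "lower n i = cell_lower b (width n i) (real (nth_prime_factor n i))"

definition upper :: "nat \<Rightarrow> nat \<Rightarrow> real" where
  "upper n i = (1 + width n i) * lower n i"

definition box_of :: "nat \<Rightarrow> nat \<Rightarrow> nat set" where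
  "box_of r n = (\<lambda>x. \<Prod>i\<in>{1..r}. x i) `
     (\<Pi>\<^sub>E i\<in>{1..r}. box_component (small_count D1 n) (nth_prime_factor n) (lower n) (upper n) i)"

text \<open>A prime factor equal to \<open>D1\<close> is ruled out because the fixed components of a
  box lie strictly below \<open>D1\<close> and its cells strictly above.\<close>

definition boxable :: "nat \<Rightarrow> real \<Rightarrow> nat \<Rightarrow> bool" where
  "boxable r N n \<longleftrightarrow> n \<in> S r N \<and> comfortably_spaced D1 n \<and> (\<forall>p\<in>prime_factors n. real p \<noteq> D1)"

lemma width_pos: "width n i > 0"
  using D1 by (simp add: width_def eta_pos)

lemma width_le:
  assumes "small_count D1 n \<le> i"
  shows "width n i \<le> 1 / 10"
proof -
  have "1 * 10 \<le> exp (real i - real (small_count D1 n)) * ln D1"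
    using assms ln_D1 by (intro mult_mono) auto
  thus ?thesis unfolding width_def eta_def by (intro divide_left_mono) auto
qed

section \<open>The box of a fixed element\<close>

context
  fixes r N n
  assumes n: "boxable r N n"
begin

lemma card_pf: "card (prime_factors n) = r"
  using n by (simp add: boxable_def S_def)

lemma nth_mono: "strict_mono_on {1..r} (nth_prime_factor n)"
  using strict_mono_on_nth_prime_factor[of n] by (simp add: card_pf)

lemma nth_image: "nth_prime_factor n ` {1..r} = prime_factors n"
  using image_nth_prime_factor[of n] by (simp add: card_pf)

lemma nth_mem: "i \<in> {1..r} \<Longrightarrow> nth_prime_factor n i \<in> prime_factors n"
  using nth_image by blast

lemma nth_less_D1_iff: "i \<in> {1..r} \<Longrightarrow> real (nth_prime_factor n i) < D1 \<longleftrightarrow> i \<le> small_count D1 n"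
  using strict_mono_on_less_iff_le_card[OF nth_mono, of i D1] unfolding small_count_def nth_image by simp

lemma small_count_le: "small_count D1 n \<le> r"
  unfolding small_count_def card_pf[symmetric] by (intro card_mono) auto

lemma nth_prime: "i \<in> {1..r} \<Longrightarrow> prime (nth_prime_factor n i)"
  using nth_mem by auto

lemma nth_mod_4: "i \<in> {1..r} \<Longrightarrow> nth_prime_factor n i mod 4 \<noteq> 3"
  using nth_mem n by (auto simp: boxable_def S_def)

lemma nth_gt:
  assumes "i \<in> {1..r}" "small_count D1 n < i"
  shows "2 * D1 < real (nth_prime_factor n i)"
proof -
  have "real (nth_prime_factor n i) \<noteq> D1" using n nth_mem[OF assms(1)] by (auto simp: boxable_def)
  hence "D1 < real (nth_prime_factor n i)" using nth_less_D1_iff[OF assms(1)] assms(2) by linarith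
  thus ?thesis using comfortably_spaced_nth(1)[of D1 n i] n assms(1) by (simp add: boxable_def card_pf)
qed

text \<open>Spacing relates consecutive primes only above \<open>D1\<close>. If the smaller prime is
  below \<open>D1\<close>, the gap comes from the requirement that a prime above \<open>D1\<close>
  even exceeds \<open>2 * D1\<close>.\<close>

lemma nth_double:
  assumes "i \<in> {1..r}" "j \<in> {1..r}" "i < j" "small_count D1 n < j"
  shows "2 * real (nth_prime_factor n i) < real (nth_prime_factor n j)"
proof (cases "small_count D1 n < i")
  case True
  have "D1 < real (nth_prime_factor n i)" using nth_gt[OF assms(1) True] D1 by linarith
  hence "2 * real (nth_prime_factor n i) < real (nth_prime_factor n (Suc i))"
    using comfortably_spaced_nth(2)[of D1 n i] n assms by (simp add: boxable_def card_pf)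
  also have "nth_prime_factor n (Suc i) \<le> nth_prime_factor n j"
    using assms strict_mono_onD[OF nth_mono, of "Suc i" j] by (cases "Suc i = j") auto
  finally show ?thesis by simp
next
  case False
  thus ?thesis using nth_less_D1_iff[OF assms(1)] nth_gt[OF assms(2,4)] by linarith
qed

lemma nth_mod_4_eq_1:
  assumes "i \<in> {1..r}" "small_count D1 n < i"
  shows "nth_prime_factor n i mod 4 = 1"
proof -
  have "nth_prime_factor n i > 2" using nth_gt[OF assms] D1 by linarith
  hence "odd (nth_prime_factor n i)" using nth_prime[OF assms(1)] prime_odd_nat by blast
  thus ?thesis using nth_mod_4[OF assms(1)] by (simp add: odd_iff_mod_4)
qed

text \<open>Strictness on the left is where the choice of the base point enters.
  \<open>D1 < lower n i\<close> holds because the prime exceeds \<open>2 * D1\<close> and its cell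
  spans less than a factor 2.\<close>

lemma cell_bounds:
  assumes "i \<in> {1..r}" "small_count D1 n < i"
  shows "lower n i < real (nth_prime_factor n i)" "real (nth_prime_factor n i) < upper n i" "D1 < lower n i"
proof -
  have e: "width n i = eta D1 (real (i - small_count D1 n))" using assms by (simp add: width_def of_nat_diff)
  have P: "real (nth_prime_factor n i) > 0" using nth_gt[OF assms] D1 by linarith
  note c = cell_lower_bounds[OF width_pos[of n i] _ P, of b]
  show "lower n i < real (nth_prime_factor n i)"
    using c(1) generic[of "nth_prime_factor n i" "i - small_count D1 n"] b unfolding lower_def e by simp
  show u: "real (nth_prime_factor n i) < upper n i"
    using c(2) b unfolding upper_def lower_def by simp
  have "(1 + width n i) * lower n i \<le> 2 * lower n i"
    using c(3) width_le[of n i] assms b unfolding lower_def by (intro mult_right_mono) auto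
  thus "D1 < lower n i" using u nth_gt[OF assms] unfolding upper_def by linarith
qed

lemma upper_less_lower:
  assumes "i \<in> {1..r}" "j \<in> {1..r}" "i < j" "small_count D1 n < i"
  shows "upper n i < lower n j"
proof -
  have j: "small_count D1 n < j" using assms by simp
  note bi = cell_bounds[OF assms(1,4)] and bj = cell_bounds[OF assms(2) j]
  \<comment> \<open>Passing from primes to cell ends costs two factors 11/10, and (11/10)^2 <
    2.\<close>
  have "upper n i \<le> 11 / 10 * lower n i"
    unfolding upper_def using width_le[of n i] assms bi D1 by (intro mult_right_mono) auto
  moreover have "upper n j \<le> 11 / 10 * lower n j"
    unfolding upper_def using width_le[of n j] j bj D1 by (intro mult_right_mono) auto
  ultimately show ?thesis using nth_double[OF assms(1-3) j] bi bj D1 by linarith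
qed

lemma is_box_box_of: "is_box D1 r (box_of r n)"
  unfolding is_box_def
proof (intro exI conjI)
  let ?k = "small_count D1 n"
  show "?k \<le> r" by (rule small_count_le)
  show "\<forall>i\<in>{1..?k}. prime (nth_prime_factor n i) \<and> nth_prime_factor n i mod 4 \<noteq> 3 \<and> real (nth_prime_factor n i) < D1"
    using nth_prime nth_mod_4 nth_less_D1_iff small_count_le by auto
  show "strict_mono_on {1..?k} (nth_prime_factor n)"
    using nth_mono by (rule monotone_on_subset) (use small_count_le in auto)
  show "?k < r \<longrightarrow> D1 < lower n (?k + 1)" using cell_bounds(3)[of "?k + 1"] by auto
  show "\<forall>i\<in>{?k+1..r}. lower n i < upper n i \<and>
      upper n i = (1 + 1 / (exp (real i - real ?k) * ln D1)) * lower n i"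
  proof
    fix i assume "i \<in> {?k+1..r}"
    hence "lower n i < upper n i" using cell_bounds(1,2)[of i] by auto
    thus "lower n i < upper n i \<and> upper n i = (1 + 1 / (exp (real i - real ?k) * ln D1)) * lower n i"
      by (simp add: upper_def width_def eta_def)
  qed
  show "\<forall>i\<in>{?k+1..<r}. upper n i < lower n (i + 1)" using upper_less_lower by auto
  show "box_of r n = (\<lambda>x. \<Prod>i\<in>{1..r}. x i) ` (\<Pi>\<^sub>E i\<in>{1..r}. box_component ?k (nth_prime_factor n) (lower n) (upper n) i)"
    by (simp add: box_of_def)
qed

lemma Prod_nth: "(\<Prod>i\<in>{1..r}. nth_prime_factor n i) = n"
proof -
  have "(\<Prod>i\<in>{1..r}. nth_prime_factor n i) = \<Prod>(nth_prime_factor n ` {1..r})"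
    using strict_mono_on_imp_inj_on[OF nth_mono] by (simp add: prod.reindex)
  also have "\<dots> = n"
    unfolding nth_image using n by (intro S_Prod_prime_factors[of n r N]) (simp add: boxable_def)
  finally show ?thesis .
qed

lemma mem_box_of: "n \<in> box_of r n"
proof -
  let ?x = "restrict (nth_prime_factor n) {1..r}"
  have "?x \<in> (\<Pi>\<^sub>E i\<in>{1..r}. box_component (small_count D1 n) (nth_prime_factor n) (lower n) (upper n) i)"
    using nth_prime nth_mod_4_eq_1 cell_bounds by (auto simp: box_component_def)
  moreover have "n = (\<Prod>i\<in>{1..r}. ?x i)" using Prod_nth by simp
  ultimately show ?thesis unfolding box_of_def by (intro image_eqI[of _ _ ?x])
qed

section \<open>Elements of that box\<close>

context
  fixes m
  assumes m: "m \<in> box_of r n"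
begin

lemma box_of_mem_coordinates:
  "\<exists>x. m = (\<Prod>i\<in>{1..r}. x i) \<and> (\<forall>i\<in>{1..r}. i \<le> small_count D1 n \<longrightarrow> x i = nth_prime_factor n i) \<and>
    (\<forall>i\<in>{1..r}. small_count D1 n < i \<longrightarrow> lower n i < real (x i) \<and> real (x i) < upper n i) \<and>
    (\<forall>i\<in>{1..r}. prime (x i) \<and> x i mod 4 \<noteq> 3) \<and> strict_mono_on {1..r} x"
proof -
  let ?k = "small_count D1 n"
  from m obtain x where xm: "m = (\<Prod>i\<in>{1..r}. x i)" and
    xP: "x \<in> (\<Pi>\<^sub>E i\<in>{1..r}. box_component ?k (nth_prime_factor n) (lower n) (upper n) i)"
    unfolding box_of_def by (rule imageE)
  note x = xm PiE_mem[OF xP]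
  have x1: "x i = nth_prime_factor n i" if "i \<in> {1..r}" "i \<le> ?k" for i
    using x(2)[OF that(1)] that by (simp add: box_component_def)
  have x2: "lower n i < real (x i)" "real (x i) < upper n i" "prime (x i)" "x i mod 4 = 1" if "i \<in> {1..r}" "?k < i" for i
    using x(2)[OF that(1)] that by (simp_all add: box_component_def)
  have x3: "prime (x i) \<and> x i mod 4 \<noteq> 3" if "i \<in> {1..r}" for i
  proof (cases "i \<le> ?k")
    case True
    thus ?thesis using x1 that nth_prime nth_mod_4 by simp
  next
    case False
    thus ?thesis using x2(3,4)[of i] that by simp
  qed
  have "strict_mono_on {1..r} x"
  proof (rule strict_mono_onI)
    fix i j assume ij: "i \<in> {1..r}" "j \<in> {1..r}" "i < j"
    consider "j \<le> ?k" | "i \<le> ?k" "?k < j" | "?k < i" by linarith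
    thus "x i < x j"
    proof cases
      case 1
      thus ?thesis using ij x1 strict_mono_onD[OF nth_mono ij] by simp
    next
      case 2
      have "real (x i) < D1" using 2 ij x1 nth_less_D1_iff by simp
      also have "D1 < real (x j)" using cell_bounds(3)[OF ij(2) 2(2)] x2(1)[OF ij(2) 2(2)] by linarith
      finally show ?thesis by simp
    next
      case 3
      have "real (x i) < real (x j)"
        using x2(2)[OF ij(1) 3] upper_less_lower[OF ij 3] x2(1)[OF ij(2)] 3 ij(3) by linarith
      thus ?thesis by simp
    qed
  qed
  with x(1) x1 x2(1,2) x3 show ?thesis by (intro exI[of _ x]) blast
qed

lemma prime_factors_mem_box_of:
  assumes "m = (\<Prod>i\<in>{1..r}. x i)" "\<And>i. i \<in> {1..r} \<Longrightarrow> prime (x i) \<and> x i mod 4 \<noteq> 3" "strict_mono_on {1..r} x"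
  shows "prime_factors m = x ` {1..r}" "\<And>N. real m < N \<Longrightarrow> m \<in> S r N"
proof -
  have inj: "inj_on x {1..r}" using assms(3) by (rule strict_mono_on_imp_inj_on)
  have mx: "m = \<Prod>(x ` {1..r})" using assms(1) inj by (simp add: prod.reindex)
  show "prime_factors m = x ` {1..r}"
    unfolding mx using assms(2) by (intro prime_factors_Prod_primes) auto
  show "m \<in> S r N" if "real m < N" for N
    unfolding mx using assms(2) inj that mx by (intro Prod_in_S) (auto simp: card_image simp del: of_nat_prod)
qed

lemma box_of_mem_S:
  assumes "real m < N'"
  shows "m \<in> S r N'"
proof -
  obtain x where x: "m = (\<Prod>i\<in>{1..r}. x i)" "\<And>i. i \<in> {1..r} \<Longrightarrow> i \<le> small_count D1 n \<Longrightarrow> x i = nth_prime_factor n i"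
    "\<And>i. i \<in> {1..r} \<Longrightarrow> small_count D1 n < i \<Longrightarrow> lower n i < real (x i) \<and> real (x i) < upper n i"
    "\<And>i. i \<in> {1..r} \<Longrightarrow> prime (x i) \<and> x i mod 4 \<noteq> 3" "strict_mono_on {1..r} x"
    using box_of_mem_coordinates by blast
  from prime_factors_mem_box_of(2)[OF x(1) x(4) x(5) assms] show ?thesis .
qed

text \<open>This makes distinct boxes disjoint. \<open>m\<close> may fail to be comfortably spaced
  or to lie below \<open>N\<close>, so its prime factors are read off from its coordinates in the
  box of \<open>n\<close>: those beyond \<open>k\<close> lie in cells above \<open>D1\<close>. Hence
  \<open>m\<close> has the same \<open>k\<close>, the same widths and, by
  \<open>cell_lower_cong\<close>, the same cells.\<close>

lemma box_of_eq: "box_of r m = box_of r n"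
proof -
  let ?k = "small_count D1 n"
  obtain x where x: "m = (\<Prod>i\<in>{1..r}. x i)" "\<And>i. i \<in> {1..r} \<Longrightarrow> i \<le> ?k \<Longrightarrow> x i = nth_prime_factor n i"
    "\<And>i. i \<in> {1..r} \<Longrightarrow> ?k < i \<Longrightarrow> lower n i < real (x i) \<and> real (x i) < upper n i"
    "\<And>i. i \<in> {1..r} \<Longrightarrow> prime (x i) \<and> x i mod 4 \<noteq> 3" "strict_mono_on {1..r} x"
    using box_of_mem_coordinates by blast
  have pf: "prime_factors m = x ` {1..r}" using x by (intro prime_factors_mem_box_of)
  have nth: "nth_prime_factor m i = x i" if "i \<in> {1..r}" for i
    using x(5) pf that by (rule nth_prime_factor_eq)
  have less: "real (x i) < D1 \<longleftrightarrow> i \<le> ?k" if "i \<in> {1..r}" for i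
  proof (cases "i \<le> ?k")
    case True
    thus ?thesis using x(2)[OF that] nth_less_D1_iff[OF that] by simp
  next
    case False
    thus ?thesis using x(3)[OF that] cell_bounds(3)[OF that] by simp
  qed
  have less': "real (x i) < D1 \<longleftrightarrow> i \<le> small_count D1 m" if "i \<in> {1..r}" for i
    using strict_mono_on_less_iff_le_card[OF x(5) that, of D1] by (simp add: small_count_def pf)
  have "small_count D1 m \<le> card (x ` {1..r})" unfolding small_count_def pf by (intro card_mono) auto
  also have "\<dots> \<le> r" using card_image_le[of "{1..r}" x] by simp
  finally have "small_count D1 m \<le> r" .
  hence k: "small_count D1 m = ?k"
    using less less' small_count_le by (metis (full_types) atLeastAtMost_iff le_antisym le_refl less_one nat_le_linear not_le zero_le)
  have low: "lower m i = lower n i" "upper m i = upper n i" if "i \<in> {1..r}" "?k < i" for i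
  proof -
    have w: "width m i = width n i" by (simp add: width_def k)
    show l: "lower m i = lower n i"
      using cell_lower_cong[OF width_pos[of n i], of b "real (nth_prime_factor n i)" "real (x i)"] x(3)[OF that] b
      unfolding lower_def upper_def w nth[OF that(1)] by simp
    show "upper m i = upper n i" unfolding upper_def w l ..
  qed
  have "(\<Pi>\<^sub>E i\<in>{1..r}. box_component (small_count D1 m) (nth_prime_factor m) (lower m) (upper m) i)
      = (\<Pi>\<^sub>E i\<in>{1..r}. box_component ?k (nth_prime_factor n) (lower n) (upper n) i)"
    using nth x(2) low by (intro PiE_cong) (auto simp: box_component_def k)
  thus ?thesis by (simp add: box_of_def)
qed

lemma box_of_mem_eq_if_all_small:
  assumes "small_count D1 n = r"
  shows "m = n"
proof -
  obtain x where x: "m = (\<Prod>i\<in>{1..r}. x i)" "\<And>i. i \<in> {1..r} \<Longrightarrow> i \<le> small_count D1 n \<Longrightarrow> x i = nth_prime_factor n i"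
    "\<And>i. i \<in> {1..r} \<Longrightarrow> small_count D1 n < i \<Longrightarrow> lower n i < real (x i) \<and> real (x i) < upper n i"
    "\<And>i. i \<in> {1..r} \<Longrightarrow> prime (x i) \<and> x i mod 4 \<noteq> 3" "strict_mono_on {1..r} x"
    using box_of_mem_coordinates by blast
  have "m = (\<Prod>i\<in>{1..r}. nth_prime_factor n i)"
    unfolding x(1) using x(2) assms by (intro prod.cong) auto
  thus ?thesis unfolding Prod_nth .
qed

text \<open>As e \<ge> 2, the widths are dominated by a geometric series of ratio 1/2; this is where
  the decay built into boxes gives a bound free of \<open>r\<close>.\<close>

lemma sum_width_le: "(\<Sum>i\<in>{small_count D1 n + 1..r}. width n i) \<le> 1 / ln D1"
proof -
  let ?k = "small_count D1 n"
  have "{?k + 1..r} = {1 + ?k..(r - ?k) + ?k}" using small_count_le by auto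
  hence "(\<Sum>i\<in>{?k + 1..r}. width n i) = (\<Sum>j=1..r - ?k. width n (j + ?k))"
    by (simp only: sum.shift_bounds_cl_nat_ivl)
  also have "\<dots> \<le> (\<Sum>j=1..r - ?k. (1 / 2) ^ j * (1 / ln D1))"
  proof (intro sum_mono)
    fix j
    have "exp (real j) = exp 1 ^ j" by (simp flip: exp_of_nat_mult)
    moreover have "exp 1 \<ge> (2::real)" using exp_ge_add_one_self[of 1] by simp
    ultimately have "2 ^ j \<le> exp (real j)" by (simp add: power_mono)
    hence "1 / exp (real j) \<le> (1 / 2) ^ j" by (simp add: power_one_over frac_le)
    hence "1 / exp (real j) * (1 / ln D1) \<le> (1 / 2) ^ j * (1 / ln D1)" using ln_D1 by (intro mult_right_mono) auto
    thus "width n (j + ?k) \<le> (1 / 2) ^ j * (1 / ln D1)" by (simp add: width_def eta_def)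
  qed
  also have "\<dots> = (\<Sum>j=1..r - ?k. (1 / 2) ^ j) * (1 / ln D1)" by (simp only: sum_distrib_right)
  also have "\<dots> \<le> 1 * (1 / ln D1)"
    using sum_power_inverse_le[of 2 "r - ?k"] ln_D1 by (intro mult_right_mono) auto
  finally show ?thesis by simp
qed

lemma box_of_mem_le: "real m \<le> exp (1 / ln D1) * real n"
proof -
  let ?k = "small_count D1 n"
  obtain x where x: "m = (\<Prod>i\<in>{1..r}. x i)" "\<And>i. i \<in> {1..r} \<Longrightarrow> i \<le> small_count D1 n \<Longrightarrow> x i = nth_prime_factor n i"
    "\<And>i. i \<in> {1..r} \<Longrightarrow> small_count D1 n < i \<Longrightarrow> lower n i < real (x i) \<and> real (x i) < upper n i"
    "\<And>i. i \<in> {1..r} \<Longrightarrow> prime (x i) \<and> x i mod 4 \<noteq> 3" "strict_mono_on {1..r} x"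
    using box_of_mem_coordinates by blast
  let ?w = "\<lambda>i. if ?k < i then width n i else 0"
  have "real m = (\<Prod>i\<in>{1..r}. real (x i))" by (simp add: x(1))
  also have "\<dots> \<le> (\<Prod>i\<in>{1..r}. exp (?w i) * real (nth_prime_factor n i))"
  proof (intro prod_mono conjI)
    fix i assume i: "i \<in> {1..r}"
    show "real (x i) \<le> exp (?w i) * real (nth_prime_factor n i)"
    proof (cases "?k < i")
      case True
      have "real (x i) \<le> (1 + width n i) * lower n i" using x(3)[OF i True] by (simp add: upper_def)
      also have "\<dots> \<le> exp (width n i) * real (nth_prime_factor n i)"
        using cell_bounds[OF i True] D1 exp_ge_add_one_self[of "width n i"] by (intro mult_mono) auto
      finally show ?thesis using True by simp
    qed (use x(2)[OF i] in simp)
  qed simp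
  also have "\<dots> = exp (\<Sum>i\<in>{1..r}. ?w i) * real (\<Prod>i\<in>{1..r}. nth_prime_factor n i)"
    by (simp add: prod.distrib exp_sum)
  also have "(\<Sum>i\<in>{1..r}. ?w i) = (\<Sum>i\<in>{?k + 1..r}. width n i)"
    by (intro sum.mono_neutral_cong_right) auto
  also have "exp (\<Sum>i\<in>{?k + 1..r}. width n i) * real (\<Prod>i\<in>{1..r}. nth_prime_factor n i) \<le> exp (1 / ln D1) * real n"
    unfolding Prod_nth using sum_width_le by (intro mult_right_mono) auto
  finally show ?thesis .
qed

end

text \<open>A box element can leave \<open>S r N\<close> only by reaching \<open>N\<close>, and it
  exceeds \<open>n\<close> by a factor of at most \<open>exp (1 / ln D1)\<close>. If all primes of
  \<open>n\<close> were below \<open>D1\<close>, the box would be \<open>{n}\<close>; so the largest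
  prime lies above \<open>D1\<close>, and spacing makes it dominate the others.\<close>

lemma box_not_subset_S:
  assumes "\<not> box_of r n \<subseteq> S r N"
  shows "N * (1 - 1 / ln D1) \<le> real n"
    and "\<exists>q\<in>prime_factors n. D1 < real q \<and> (\<forall>p\<in>prime_factors n - {q}. 2 * p < q)"
proof -
  from assms obtain m where m: "m \<in> box_of r n" "m \<notin> S r N" by blast
  have nS: "n \<in> S r N" using n by (simp add: boxable_def)
  have "N \<le> real m" using box_of_mem_S[OF m(1), of N] m(2) by linarith
  also have "\<dots> \<le> exp (1 / ln D1) * real n" by (rule box_of_mem_le[OF m(1)])
  finally have "N * exp (- (1 / ln D1)) \<le> real n" by (simp add: exp_minus field_simps)
  moreover have "N > 0" using nS by (simp add: S_def)
  hence "N * (1 - 1 / ln D1) \<le> N * exp (- (1 / ln D1))"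
    using exp_ge_add_one_self[of "- (1 / ln D1)"] by (intro mult_left_mono) auto
  ultimately show "N * (1 - 1 / ln D1) \<le> real n" by linarith
  have "small_count D1 n \<noteq> r" using box_of_mem_eq_if_all_small[OF m(1)] m(2) nS by blast
  hence k: "small_count D1 n < r" using small_count_le by simp
  hence r: "r \<in> {1..r}" by simp
  show "\<exists>q\<in>prime_factors n. D1 < real q \<and> (\<forall>p\<in>prime_factors n - {q}. 2 * p < q)"
  proof (intro bexI[of _ "nth_prime_factor n r"] conjI ballI)
    show "D1 < real (nth_prime_factor n r)" using nth_gt[OF r k] D1 by linarith
    fix p assume p: "p \<in> prime_factors n - {nth_prime_factor n r}"
    then obtain i where i: "i \<in> {1..r}" "p = nth_prime_factor n i" using nth_image by blast
    have "i \<noteq> r" using p i by auto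
    hence "2 * real (nth_prime_factor n i) < real (nth_prime_factor n r)" using i r k by (intro nth_double) auto
    thus "2 * p < nth_prime_factor n r" unfolding i(2) by linarith
  qed (rule nth_mem[OF r])
qed

end

end

section \<open>The density estimate\<close>

lemma card_Int_Union_approx:
  fixes \<delta> \<epsilon> :: real
  assumes "finite F" "\<And>X. X \<in> F \<Longrightarrow> finite X"
    and disj: "\<And>X Y. X \<in> F \<Longrightarrow> Y \<in> F \<Longrightarrow> X \<noteq> Y \<Longrightarrow> X \<inter> Y = {}"
    and approx: "\<And>X. X \<in> F \<Longrightarrow> \<bar>real (card (V \<inter> X)) - \<delta> * real (card X)\<bar> \<le> \<epsilon> * real (card X)"
  shows "\<bar>real (card (V \<inter> \<Union>F)) - \<delta> * real (card (\<Union>F))\<bar> \<le> \<epsilon> * real (card (\<Union>F))"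
proof -
  have "card (\<Union>X\<in>F. X) = (\<Sum>X\<in>F. card X)"
    using assms by (intro card_UN_disjoint) auto
  hence c: "card (\<Union>F) = (\<Sum>X\<in>F. card X)" by simp
  have "card (\<Union>X\<in>F. V \<inter> X) = (\<Sum>X\<in>F. card (V \<inter> X))"
  proof (intro card_UN_disjoint ballI impI)
    fix X Y assume "X \<in> F" "Y \<in> F" "X \<noteq> Y"
    thus "(V \<inter> X) \<inter> (V \<inter> Y) = {}" using disj by blast
  qed (use assms(1,2) in auto)
  moreover have "(\<Union>X\<in>F. V \<inter> X) = V \<inter> \<Union>F" by blast
  ultimately have cV: "card (V \<inter> \<Union>F) = (\<Sum>X\<in>F. card (V \<inter> X))" by simp
  have "\<bar>real (card (V \<inter> \<Union>F)) - \<delta> * real (card (\<Union>F))\<bar>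
      = \<bar>\<Sum>X\<in>F. real (card (V \<inter> X)) - \<delta> * real (card X)\<bar>"
    by (simp add: c cV sum_subtractf sum_distrib_left)
  also have "\<dots> \<le> (\<Sum>X\<in>F. \<bar>real (card (V \<inter> X)) - \<delta> * real (card X)\<bar>)" by (rule sum_abs)
  also have "\<dots> \<le> (\<Sum>X\<in>F. \<epsilon> * real (card X))" using approx by (intro sum_mono)
  also have "\<dots> = \<epsilon> * real (card (\<Union>F))" by (simp add: c sum_distrib_left)
  finally show ?thesis .
qed

lemma abs_diff_mult_le_max:
  fixes a c \<delta> :: real
  assumes "0 \<le> a" "a \<le> c" "0 < \<delta>"
  shows "\<bar>a - \<delta> * c\<bar> \<le> max 1 \<delta> * c"
proof -
  have "1 * c \<le> max 1 \<delta> * c" "\<delta> * c \<le> max 1 \<delta> * c" "0 \<le> \<delta> * c"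
    using assms by (intro mult_right_mono mult_nonneg_nonneg; simp)+
  thus ?thesis using assms by linarith
qed

lemma density_from_covered_part:
  fixes \<delta> \<epsilon> :: real
  assumes "finite A" "V \<subseteq> A" "Y \<subseteq> A" "0 < \<delta>" "0 < \<epsilon>"
    and approx: "\<bar>real (card (V \<inter> Y)) - \<delta> * real (card Y)\<bar> \<le> \<epsilon> * real (card Y)"
  shows "\<bar>real (card V) - \<delta> * real (card A)\<bar> \<le> \<epsilon> * real (card A) + max 1 \<delta> * real (card (A - Y))"
proof -
  have fin: "finite V" "finite Y" using assms finite_subset by blast+
  have "card V = card ((V \<inter> Y) \<union> (V - Y))" by (rule arg_cong[of _ _ card]) blast
  also have "\<dots> = card (V \<inter> Y) + card (V - Y)" using fin by (intro card_Un_disjoint) auto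
  finally have cV: "card V = card (V \<inter> Y) + card (V - Y)" .
  have cA: "real (card A) = real (card Y) + real (card (A - Y))"
    using assms(1,3) fin card_mono[OF assms(1,3)] by (simp add: card_Diff_subset)
  have "card (V - Y) \<le> card (A - Y)" using assms(1,2) by (intro card_mono) auto
  hence "\<bar>real (card (V - Y)) - \<delta> * real (card (A - Y))\<bar> \<le> max 1 \<delta> * real (card (A - Y))"
    using assms(4) by (intro abs_diff_mult_le_max) auto
  moreover have "\<epsilon> * real (card Y) \<le> \<epsilon> * real (card A)" using cA assms(5) by (intro mult_left_mono) auto
  moreover have "real (card V) - \<delta> * real (card A) = (real (card (V \<inter> Y)) - \<delta> * real (card Y))
      + (real (card (V - Y)) - \<delta> * real (card (A - Y)))"
    by (simp add: cV cA algebra_simps)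
  ultimately show ?thesis using approx by linarith
qed

text \<open>Two thresholds are kept apart, an absolute one and one depending on \<open>r\<close>
  that is demanded only when \<open>D1\<close> is a prime factor of an element of \<open>W\<close>.
  This keeps the constant absolute otherwise.\<close>

lemma density_error:
  "\<exists>C0\<ge>10. \<exists>L0 :: nat \<Rightarrow> real. \<forall>N D1 r W V \<epsilon> \<delta>. 3 \<le> D1 \<longrightarrow> C0 \<le> ln D1 \<longrightarrow>
     ((\<exists>n\<in>W. \<exists>p\<in>prime_factors n. real p = D1) \<longrightarrow> L0 r \<le> ln D1) \<longrightarrow> 0 < \<epsilon> \<longrightarrow> 0 < \<delta> \<longrightarrow>
     W \<subseteq> S r N \<longrightarrow> (\<forall>n\<in>W. comfortably_spaced D1 n) \<longrightarrow>
     \<bar>real (card W) - real (Phi r N)\<bar> < \<epsilon> * real (Phi r N) \<longrightarrow> V \<subseteq> S r N \<longrightarrow>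
     (\<forall>X. is_box D1 r X \<longrightarrow> X \<subseteq> S r N \<longrightarrow> X \<inter> W \<noteq> {} \<longrightarrow>
        \<bar>real (card (V \<inter> X)) - \<delta> * real (card X)\<bar> < \<epsilon> * real (card X)) \<longrightarrow>
     \<bar>real (card V) - \<delta> * real (Phi r N)\<bar> \<le> \<epsilon> * real (Phi r N) + max 1 \<delta> * (\<epsilon> +
        (10400 + (if \<exists>n\<in>W. \<exists>p\<in>prime_factors n. real p = D1 then real r else 0)) / ln D1) * real (Phi r N)"
proof -
  obtain L1 where L1: "\<And>N D1 r B. 3 \<le> D1 \<Longrightarrow> L1 \<le> ln D1 \<Longrightarrow> B \<subseteq> S r N \<Longrightarrow>
     (\<forall>n\<in>B. N * (1 - 1 / ln D1) \<le> real n \<and>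
        (\<exists>q\<in>prime_factors n. D1 < real q \<and> (\<forall>p\<in>prime_factors n - {q}. 2 * p < q))) \<Longrightarrow>
     real (card B) \<le> 10400 / ln D1 * real (Phi r N)"
    using boundary_count by blast
  have "\<forall>r. \<exists>L0. \<forall>N d. prime d \<longrightarrow> d mod 4 = 1 \<longrightarrow> L0 \<le> ln (real d) \<longrightarrow>
     real (card {n \<in> S r N. d \<in> prime_factors n}) \<le> real r / ln (real d) * real (Phi r N)"
    using multiples_of_prime_count by blast
  from choice[OF this] obtain L2 where L2: "\<And>r N d. prime d \<Longrightarrow> d mod 4 = 1 \<Longrightarrow> L2 r \<le> ln (real d) \<Longrightarrow>
     real (card {n \<in> S r N. d \<in> prime_factors n}) \<le> real r / ln (real d) * real (Phi r N)"
    by blast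
  show ?thesis
  proof (rule exI[of _ "max 10 L1"], intro conjI, simp, rule exI[of _ L2], intro allI impI)
    fix N D1 :: real and r W V and \<epsilon> \<delta> :: real
    let ?E = "\<exists>n\<in>W. \<exists>p\<in>prime_factors n. real p = D1"
    assume D1: "3 \<le> D1" and C0: "max 10 L1 \<le> ln D1" and E: "?E \<longrightarrow> L2 r \<le> ln D1"
      and \<epsilon>: "0 < \<epsilon>" and \<delta>: "0 < \<delta>" and W: "W \<subseteq> S r N" and spaced: "\<forall>n\<in>W. comfortably_spaced D1 n"
      and cW: "\<bar>real (card W) - real (Phi r N)\<bar> < \<epsilon> * real (Phi r N)" and V: "V \<subseteq> S r N"
      and boxes: "\<forall>X. is_box D1 r X \<longrightarrow> X \<subseteq> S r N \<longrightarrow> X \<inter> W \<noteq> {} \<longrightarrow>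
        \<bar>real (card (V \<inter> X)) - \<delta> * real (card X)\<bar> < \<epsilon> * real (card X)"
    have L: "10 \<le> ln D1" "L1 \<le> ln D1" using C0 by auto
    obtain b where b: "1 < b" "\<And>(q::nat) (j::nat). real q \<noteq> cell_lower b (eta D1 (real j)) (real q)"
      using generic_base[of D1] D1 by auto
    interpret prime_grid D1 b using D1 L b by unfold_locales auto
    define B1 where "B1 = {n \<in> W. \<exists>p\<in>prime_factors n. real p = D1}"
    define Good where "Good = {n \<in> W. \<not> (\<exists>p\<in>prime_factors n. real p = D1)}"
    define B2 where "B2 = {n \<in> Good. \<not> box_of r n \<subseteq> S r N}"
    \<comment> \<open>A set of boxes, not a family indexed by elements: a box arising from several
      elements of \<open>W\<close> counts once.\<close>
    define F where "F = box_of r ` {n \<in> Good. box_of r n \<subseteq> S r N}"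
    have good: "boxable r N n" if "n \<in> Good" for n
      using that W spaced by (auto simp: Good_def boxable_def)
    have finW: "finite W" using W finite_S finite_subset by blast
    have finF: "finite F" using finW by (simp add: F_def Good_def)
    have FS: "X \<subseteq> S r N" if "X \<in> F" for X using that by (auto simp: F_def)
    have "\<bar>real (card (V \<inter> \<Union>F)) - \<delta> * real (card (\<Union>F))\<bar> \<le> \<epsilon> * real (card (\<Union>F))"
    proof (rule card_Int_Union_approx[OF finF])
      show "finite X" if "X \<in> F" for X using FS[OF that] finite_S finite_subset by blast
      show "X \<inter> Y = {}" if XY: "X \<in> F" "Y \<in> F" "X \<noteq> Y" for X Y
      proof (rule ccontr)
        assume "X \<inter> Y \<noteq> {}"
        then obtain m where m: "m \<in> X" "m \<in> Y" by blast
        from XY obtain n n' where n: "n \<in> Good" "n' \<in> Good" "X = box_of r n" "Y = box_of r n'"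
          by (auto simp: F_def)
        have "box_of r m = X" using box_of_eq[OF good[OF n(1)]] m n by simp
        moreover have "box_of r m = Y" using box_of_eq[OF good[OF n(2)]] m n by simp
        ultimately show False using XY by simp
      qed
      show "\<bar>real (card (V \<inter> X)) - \<delta> * real (card X)\<bar> \<le> \<epsilon> * real (card X)" if X: "X \<in> F" for X
      proof -
        from X obtain n where n: "n \<in> Good" "X = box_of r n" by (auto simp: F_def)
        have "is_box D1 r X" unfolding n by (rule is_box_box_of[OF good[OF n(1)]])
        \<comment> \<open>The element that generated the box shows that it meets \<open>W\<close>,
          so the hypothesis on boxes applies.\<close>
        moreover have "n \<in> X \<inter> W" using mem_box_of[OF good[OF n(1)]] n by (simp add: Good_def)
        ultimately show ?thesis using boxes FS[OF X] by (intro less_imp_le) blast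
      qed
    qed
    hence main: "\<bar>real (card V) - \<delta> * real (card (S r N))\<bar>
        \<le> \<epsilon> * real (card (S r N)) + max 1 \<delta> * real (card (S r N - \<Union>F))"
      using V FS \<delta> \<epsilon> by (intro density_from_covered_part finite_S) auto
    have "n \<in> \<Union>F" if "n \<in> Good" "n \<notin> B2" for n
      using that mem_box_of[OF good[OF that(1)]] by (auto simp: F_def B2_def)
    \<comment> \<open>An uncovered element lies outside \<open>W\<close>, has the prime factor
      \<open>D1\<close>, or has a box that leaves \<open>S r N\<close>.\<close>
    hence "S r N - \<Union>F \<subseteq> (S r N - W) \<union> B1 \<union> B2" by (auto simp: B1_def Good_def)
    moreover have fin: "finite (S r N - W)" "finite B1" "finite B2"
      using finite_S finW by (auto simp: B1_def B2_def Good_def)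
    ultimately have "card (S r N - \<Union>F) \<le> card ((S r N - W) \<union> B1 \<union> B2)" by (intro card_mono) auto
    also have "\<dots> \<le> card (S r N - W) + card B1 + card B2"
      using card_Un_le[of "(S r N - W) \<union> B1" B2] card_Un_le[of "S r N - W" B1] by linarith
    finally have "real (card (S r N - \<Union>F)) \<le> real (card (S r N - W)) + real (card B1) + real (card B2)"
      by linarith
    also have "real (card (S r N - W)) \<le> \<epsilon> * real (Phi r N)"
      using cW card_Diff_subset[OF finW W] card_mono[OF finite_S W] by (simp add: Phi_def of_nat_diff)
    also have "real (card B1) \<le> (if ?E then real r else 0) / ln D1 * real (Phi r N)"
    proof (cases ?E)
      case True
      then obtain n d where d: "n \<in> W" "d \<in> prime_factors n" "real d = D1" by blast
      have pd: "prime d" using d by auto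
      have "d > 2" using d D1 by linarith
      hence "odd d" using pd prime_odd_nat by blast
      moreover have "d mod 4 \<noteq> 3" using d W by (auto simp: S_def)
      ultimately have d4: "d mod 4 = 1" by (simp add: odd_iff_mod_4)
      have "B1 \<subseteq> {n \<in> S r N. d \<in> prime_factors n}"
      proof
        fix m assume "m \<in> B1"
        then obtain p where p: "m \<in> W" "p \<in> prime_factors m" "real p = D1" by (auto simp: B1_def)
        have "p = d" using p(3) d(3) by simp
        thus "m \<in> {n \<in> S r N. d \<in> prime_factors n}" using p W by auto
      qed
      hence "card B1 \<le> card {n \<in> S r N. d \<in> prime_factors n}"
        using finite_S by (intro card_mono) auto
      also have "real (card {n \<in> S r N. d \<in> prime_factors n}) \<le> real r / ln D1 * real (Phi r N)"
        using L2[OF pd d4, of r N] E True d by simp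
      finally show ?thesis using True by simp
    next
      case False
      hence "B1 = {}" by (auto simp: B1_def)
      with False show ?thesis by simp
    qed
    also have "real (card B2) \<le> 10400 / ln D1 * real (Phi r N)"
    proof (rule L1[OF D1 L(2)])
      show "B2 \<subseteq> S r N" using W by (auto simp: B2_def Good_def)
      show "\<forall>n\<in>B2. N * (1 - 1 / ln D1) \<le> real n \<and>
        (\<exists>q\<in>prime_factors n. D1 < real q \<and> (\<forall>p\<in>prime_factors n - {q}. 2 * p < q))"
      proof
        fix n assume "n \<in> B2"
        hence "boxable r N n" "\<not> box_of r n \<subseteq> S r N" using good by (auto simp: B2_def)
        thus "N * (1 - 1 / ln D1) \<le> real n \<and>
          (\<exists>q\<in>prime_factors n. D1 < real q \<and> (\<forall>p\<in>prime_factors n - {q}. 2 * p < q))"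
          by (intro conjI box_not_subset_S)
      qed
    qed
    finally have "real (card (S r N - \<Union>F)) \<le> (\<epsilon> + (10400 + (if ?E then real r else 0)) / ln D1) * real (Phi r N)"
      by (simp add: algebra_simps add_divide_distrib)
    hence "max 1 \<delta> * real (card (S r N - \<Union>F))
        \<le> max 1 \<delta> * ((\<epsilon> + (10400 + (if ?E then real r else 0)) / ln D1) * real (Phi r N))"
      by (intro mult_left_mono) auto
    with main show "\<bar>real (card V) - \<delta> * real (Phi r N)\<bar> \<le> \<epsilon> * real (Phi r N) + max 1 \<delta> * (\<epsilon> +
        (10400 + (if ?E then real r else 0)) / ln D1) * real (Phi r N)"
      unfolding Phi_def mult.assoc by linarith
  qed
qed

text \<open>The implied constant is \<open>C * max 1 \<delta>\<close> with \<open>C\<close>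
  absolute, and it depends on \<open>r\<close> only when some element of \<open>W\<close> has
  \<open>D1\<close> itself as a prime factor. No box contains such an element, so the hypothesis on
  boxes gives no information about it. The factor \<open>max 1 \<delta>\<close> allows for
  \<open>\<delta>\<close> above 1.\<close>

theorem theorem5p12:
  "\<exists>(C :: real) (K :: nat \<Rightarrow> real).
     \<forall>(N :: real) (D1 :: real) (r :: nat) (W :: nat set) (V :: nat set) (\<epsilon> :: real) (\<delta> :: real).
       3 \<le> D1 \<longrightarrow> D1 \<le> N \<longrightarrow> (ln D1)\<^sup>2 \<le> ln N \<longrightarrow> 1 \<le> r \<longrightarrow>
       0 < \<epsilon> \<longrightarrow> 0 < \<delta> \<longrightarrow>
       W \<subseteq> S r N \<longrightarrow> (\<forall>n\<in>W. comfortably_spaced D1 n) \<longrightarrow>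
       \<bar>real (card W) - real (Phi r N)\<bar> < \<epsilon> * real (Phi r N) \<longrightarrow>
       V \<subseteq> S r N \<longrightarrow>
       (\<forall>X. is_box D1 r X \<longrightarrow> X \<subseteq> S r N \<longrightarrow> X \<inter> W \<noteq> {} \<longrightarrow>
          \<bar>real (card (V \<inter> X)) - \<delta> * real (card X)\<bar> < \<epsilon> * real (card X)) \<longrightarrow>
       \<bar>real (card V) - \<delta> * real (Phi r N)\<bar>
         \<le> (if \<exists>n\<in>W. \<exists>p\<in>prime_factors n. real p = D1 then K r else C) * max 1 \<delta>
             * (\<epsilon> + 1 / ln D1) * real (Phi r N)"
proof -
  obtain C0 L0 where C0: "C0 \<ge> 10" and main: "\<And>N D1 r W V \<epsilon> \<delta>. 3 \<le> D1 \<Longrightarrow> C0 \<le> ln D1 \<Longrightarrow>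
     ((\<exists>n\<in>W. \<exists>p\<in>prime_factors n. real p = D1) \<longrightarrow> L0 r \<le> ln D1) \<Longrightarrow> 0 < \<epsilon> \<Longrightarrow> 0 < \<delta> \<Longrightarrow>
     W \<subseteq> S r N \<Longrightarrow> (\<forall>n\<in>W. comfortably_spaced D1 n) \<Longrightarrow>
     \<bar>real (card W) - real (Phi r N)\<bar> < \<epsilon> * real (Phi r N) \<Longrightarrow> V \<subseteq> S r N \<Longrightarrow>
     (\<forall>X. is_box D1 r X \<longrightarrow> X \<subseteq> S r N \<longrightarrow> X \<inter> W \<noteq> {} \<longrightarrow>
        \<bar>real (card (V \<inter> X)) - \<delta> * real (card X)\<bar> < \<epsilon> * real (card X)) \<Longrightarrow>
     \<bar>real (card V) - \<delta> * real (Phi r N)\<bar> \<le> \<epsilon> * real (Phi r N) + max 1 \<delta> * (\<epsilon> +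
        (10400 + (if \<exists>n\<in>W. \<exists>p\<in>prime_factors n. real p = D1 then real r else 0)) / ln D1) * real (Phi r N)"
    using density_error by (elim exE conjE) blast
  \<comment> \<open>The constants have two duties: to dominate the coefficient of
    \<open>1 / ln D1\<close> in \<open>density_error\<close>, and to be at least
    \<open>ln D1\<close> whenever one of its thresholds fails. \<open>C0\<close> and
    \<open>\<bar>L0 r\<bar>\<close> serve the second.\<close>
  define C where "C = 10402 + C0"
  define K where "K = (\<lambda>r. C + real r + \<bar>L0 r\<bar>)"
  show ?thesis
  proof (rule exI[of _ C], rule exI[of _ K], intro allI impI)
    fix N D1 :: real and r :: nat and W V :: "nat set" and \<epsilon> \<delta> :: real
    let ?E = "\<exists>n\<in>W. \<exists>p\<in>prime_factors n. real p = D1"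
    assume D1: "3 \<le> D1" and \<epsilon>: "0 < \<epsilon>" and \<delta>: "0 < \<delta>" and W: "W \<subseteq> S r N"
      and spaced: "\<forall>n\<in>W. comfortably_spaced D1 n"
      and cW: "\<bar>real (card W) - real (Phi r N)\<bar> < \<epsilon> * real (Phi r N)" and V: "V \<subseteq> S r N"
      and boxes: "\<forall>X. is_box D1 r X \<longrightarrow> X \<subseteq> S r N \<longrightarrow> X \<inter> W \<noteq> {} \<longrightarrow>
        \<bar>real (card (V \<inter> X)) - \<delta> * real (card X)\<bar> < \<epsilon> * real (card X)"
    define M where "M = (if ?E then K r else C)"
    have lnD1: "ln D1 > 0" using D1 by simp
    define P where "P = max 1 \<delta> * real (Phi r N)"
    have P: "P \<ge> 0" "real (Phi r N) \<le> P" by (auto simp: P_def mult_le_cancel_right1)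
    have "\<bar>real (card V) - \<delta> * real (Phi r N)\<bar> \<le> M * (\<epsilon> + 1 / ln D1) * P"
    proof (cases "C0 \<le> ln D1 \<and> (?E \<longrightarrow> L0 r \<le> ln D1)")
      case True
      define R where "R = 10400 + (if ?E then real r else 0)"
      have M: "R \<le> M" "2 \<le> M" using C0 by (auto simp: R_def M_def K_def C_def)
      have "\<bar>real (card V) - \<delta> * real (Phi r N)\<bar>
          \<le> \<epsilon> * real (Phi r N) + max 1 \<delta> * (\<epsilon> + R / ln D1) * real (Phi r N)"
        unfolding R_def using True by (intro main D1 \<epsilon> \<delta> W spaced cW V boxes) auto
      also have "max 1 \<delta> * (\<epsilon> + R / ln D1) * real (Phi r N) = (\<epsilon> + R / ln D1) * P"
        by (simp add: P_def)
      also have "\<epsilon> * real (Phi r N) \<le> \<epsilon> * P" using P \<epsilon> by (intro mult_left_mono) auto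
      also have "\<epsilon> * P + (\<epsilon> + R / ln D1) * P = (2 * \<epsilon> + R * (1 / ln D1)) * P" by (simp add: algebra_simps)
      also have "\<dots> \<le> (M * \<epsilon> + M * (1 / ln D1)) * P"
        using P M \<epsilon> lnD1 by (intro mult_right_mono add_mono) auto
      finally show ?thesis by (simp add: algebra_simps)
    next
      case False
      \<comment> \<open>Below a threshold the trivial bound \<open>max 1 \<delta> * Phi r N\<close>
        suffices, because \<open>M / ln D1 \<ge> 1\<close>.\<close>
      have "M \<ge> ln D1" using False C0 by (auto simp: M_def K_def C_def)
      hence "1 \<le> M * (1 / ln D1)" using lnD1 by (simp add: field_simps)
      also have "\<dots> \<le> M * (\<epsilon> + 1 / ln D1)" using \<epsilon> lnD1 \<open>M \<ge> ln D1\<close> by (intro mult_left_mono) auto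
      finally have "1 * P \<le> M * (\<epsilon> + 1 / ln D1) * P" using P by (intro mult_right_mono)
      moreover have "card V \<le> Phi r N" unfolding Phi_def by (intro card_mono finite_S V)
      hence "\<bar>real (card V) - \<delta> * real (Phi r N)\<bar> \<le> P"
        unfolding P_def using \<delta> by (intro abs_diff_mult_le_max) auto
      ultimately show ?thesis by linarith
    qed
    thus "\<bar>real (card V) - \<delta> * real (Phi r N)\<bar>
         \<le> (if ?E then K r else C) * max 1 \<delta> * (\<epsilon> + 1 / ln D1) * real (Phi r N)"
      unfolding M_def[symmetric] P_def by (simp add: mult_ac)
  qed
qed

end
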